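(* Let $\mathcal{S}$ be a (full) triangulation of a locally finite set $\mathcal{V}=\{\mathbf{v}_k\}_{k\in I}$ of vertices in $\mathbb{R}^d$, and let $(\beta^{\mathcal{S}}_{\mathbf{v}})_{\mathbf{v}\in\mathcal{V}}$ be the corresponding hat functions. Then the following statements are equivalent: (i) the collection of functions $(\beta^{\mathcal{S}}_{\mathbf{v}})_{\mathbf{v}\in\mathcal{V}}$ forms a Riesz basis of the space $\mathrm{CPWL}(\mathcal{S})\cap L_2(\mathrm{conv}(\mathcal{V}))$; (ii) $V^{\mathrm{St}}_{\inf} := \inf_{\mathbf{v} \in \mathcal{V}}\mathrm{vol}(\mathrm{St}(\mathbf{v})) > 0$ and $V^{\mathrm{St}}_{\sup} := \sup_{\mathbf{v} \in \mathcal{V}}\mathrm{vol}(\mathrm{St}(\mathbf{v})) < + \infty$; (iii) $\inf_{\mathbf{v} \in \mathcal{V}}\|\beta^{\mathcal{S}}_{\mathbf{v}}\|_{L_2} > 0$ and $\sup_{\mathbf{v} \in \mathcal{V}}\|\beta^{\mathcal{S}}_{\mathbf{v}}\|_{L_2} < + \infty$. When these statements hold, for any $c=(c_{\mathbf{v}})_{\mathbf{v}\in\mathcal{V}} \in \ell_2(I)$ we have $$\sqrt{\frac{V^{\mathrm{St}}_{\inf}}{(d+1)(d+2)}}\,\|c\|_{\ell_2} \leq \Big\|\sum_{\mathbf{v}\in\mathcal{V}}c_{\mathbf{v}} \beta^{\mathcal{S}}_{\mathbf{v}}\Big\|_{L_2}\leq \sqrt{\frac{V^{\mathrm{St}}_{\sup}}{d+1}}\,\|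 c\|_{\ell_2}$$ or, equivalently, $$\frac{1}{\sqrt{2}}\inf_{\mathbf{v} \in \mathcal{V}}\|\beta^{\mathcal{S}}_{\mathbf{v}}\|_{L_2}\,\| c\|_{\ell_2} \leq \Big\|\sum_{\mathbf{v}\in\mathcal{V}}c_{\mathbf{v}} \beta^{\mathcal{S}}_{\mathbf{v}}\Big\|_{L_2}\leq \sqrt{\frac{d+2}{2}} \sup_{\mathbf{v} \in \mathcal{V}}\|\beta^{\mathcal{S}}_{\mathbf{v}}\|_{L_2}\, \| c\|_{\ell_2},$$ and the Riesz condition number $r$ of the collection satisfies $$r \leq \sqrt{d+2}\,\sqrt{\frac{V^{\mathrm{St}}_{\sup}}{V^{\mathrm{St}}_{\inf}}} = \sqrt{d+2}\times \frac{ \sup_{\mathbf{v} \in \mathcal{V}}\|\beta^{\mathcal{S}}_{\mathbf{v}}\|_{L_2}}{ \inf_{\mathbf{v} \in \mathcal{V}}\|\beta^{\mathcal{S}}_{\mathbf{v}}\|_{L_2}}.$$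
   Context: Here $d\ge 1$ and $\mathrm{vol}$ is $d$-dimensional Lebesgue measure. A set $\mathcal{V}\subset\mathbb{R}^d$ is locally finite if its intersection with every compact set is finite. Throughout, $\mathcal{V}=\{\mathbf{v}_k\}_{k\in I}$ is locally finite, indexed by $I\subset\mathbb{N}$, and not contained in any $(d-1)$-dimensional affine subspace of $\mathbb{R}^d$; sequences $c\in\ell_2(I)$ are written $(c_{\mathbf{v}})_{\mathbf{v}\in\mathcal{V}}$ through this indexing. A $d$-simplex is the convex hull of $d+1$ affinely independent points (its vertices); a $k$-face is the convex hull of $k+1$ of its vertices. A triangulation of $\mathcal{V}$ is a collection $\mathcal{S}$ of $d$-simplices whose vertices are points of $\mathcal{V}$ such that the union of all simplices equals $\mathrm{conv}(\mathcal{V})$ and any two simplices intersect in a (possibly empty) common face. It is full if every point of $\mathcal{V}$ is a vertex of some simplex; all triangulations are assumed full. The star $\mathrm{St}(\mathbf{v})$ of $\mathbf{v}\in\mathcal{V}$ is the set of simplices of $\mathcal{S}$ that contain $\mathbf{v}$, and $\mathrm{vol}(\mathrm{St}(\mathbf{v}))=\sum_{s\in \mathrm{St}(\mathbf{v})}\mathrm{vol}(s)$. $\mathrm{CPWL}(\mathcal{S})$ is the set of (complex-valued) functions on $\mathrm{conv}(\mathcal{V})$ that are continuous on $\mathrm{conv}(\mathcal{V})$ and affine on each $s\in\mathcal{S}$. The hat function $\beta^{\mathcal{S}}_{\mathbf{v}}:\mathrm{conv}(\mathcal{V})\to\mathbb{R}$ is defined on each simplex $s\in\mathcal{S}$ by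 $\beta^{\mathcal{S}}_{\mathbf{v}}|_s=\lambda^s_{\mathbf{v}}$ if $s\in\mathrm{St}(\mathbf{v})$ and $\beta^{\mathcal{S}}_{\mathbf{v}}|_s=0$ otherwise, where $\lambda^s_{\mathbf{v}}$ is the unique affine function equal to $1$ at $\mathbf{v}$ and $0$ at all other vertices of $s$. For functions on $\mathrm{conv}(\mathcal{V})$, $\|f\|_{L_2}=(\int_{\mathrm{conv}(\mathcal{V})}|f(\mathbf{x})|^2\,d\mathbf{x})^{1/2}$. $\ell_2(I)$ is the space of complex-valued square-summable sequences indexed by $I$, with $\|c\|_{\ell_2}=(\sum_{k\in I}|c_k|^2)^{1/2}$. A collection $\{\varphi_k\}_{k\in I}$ in a space $\mathcal{H}$ (with $L_2$ norm) is a Riesz basis of $\mathcal{H}$ if the closure of its linear span is $\mathcal{H}$ and there exist $0<A\le B<\infty$ such that $A\|c\|_{\ell_2}\le\|\sum_{k\in I}c_k\varphi_k\|_{L_2}\le B\|c\|_{\ell_2}$ for all $c\in\ell_2(I)$. The tightest such $A$ and $B$ are the Riesz bounds, and $B/A$ is the Riesz condition number.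
   Formalization: (ii)⇒(i) and (iii)⇒(i) are stated only when all hat functions are continuous, i.e. lie in CPWL(S); if infinitely many simplices accumulate at a point this can fail and the implication is then false. All other claims, including (i)⇒(ii)⇔(iii) and the bounds, are unconditional. *)

theory Defs
  imports "HOL-Analysis.Analysis"
begin

definition locally_finite_set :: "'a::topological_space set \<Rightarrow> bool" where
  "locally_finite_set V \<longleftrightarrow> (\<forall>K. compact K \<longrightarrow> finite (V \<inter> K))"

definition affine_function :: "('a::real_vector \<Rightarrow> 'b::real_vector) \<Rightarrow> bool" where
  "affine_function f \<longleftrightarrow> (\<exists>g b. linear g \<and> f = (\<lambda>x. g x + b))"


subsection \<open>Simplices and triangulations\<close>

definition simplex_vertices :: "'a::euclidean_space set \<Rightarrow> 'a set" where
  "simplex_vertices s = (THE C. \<not> affine_dependent C \<and> s = convex hull C)"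

text \<open>The dimension of a face is left open; the choice \<open>W = {}\<close> gives the empty face.\<close>

definition simplex_face :: "'a::euclidean_space set \<Rightarrow> 'a set \<Rightarrow> bool" where
  "simplex_face F s \<longleftrightarrow> (\<exists>W. W \<subseteq> simplex_vertices s \<and> F = convex hull W)"

lemma simplex_vertices_convex_hull:
  fixes C :: "'a::euclidean_space set"
  assumes "\<not> affine_dependent C"
  shows "simplex_vertices (convex hull C) = C"
  unfolding simplex_vertices_def
proof (rule the_equality)
  show "\<not> affine_dependent C \<and> convex hull C = convex hull C"
    using assms by simp
next
  fix D :: "'a set"
  assume D: "\<not> affine_dependent D \<and> convex hull C = convex hull D"
  have "x \<in> D \<longleftrightarrow> x \<in> C" for x
    using D assms extreme_point_of_convex_hull_affine_independent by metis
  then show "D = C" by blast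
qed

lemma simplex_face_iff_face_of:
  assumes "n simplex s"
  shows "simplex_face F s \<longleftrightarrow> F face_of s"
proof -
  obtain C where "\<not> affine_dependent C" "s = convex hull C"
    using assms unfolding simplex_def by blast
  then show ?thesis
    by (auto simp: simplex_face_def simplex_vertices_convex_hull
        face_of_convex_hull_affine_independent)
qed

definition full_triangulation :: "'a::euclidean_space set \<Rightarrow> 'a set set \<Rightarrow> bool" where
  "full_triangulation V S \<longleftrightarrow>
     (\<forall>s\<in>S. int DIM('a) simplex s \<and> simplex_vertices s \<subseteq> V) \<and>
     \<Union>S = convex hull V \<and>
     (\<forall>s\<in>S. \<forall>t\<in>S. simplex_face (s \<inter> t) s \<and> simplex_face (s \<inter> t) t) \<and>
     (\<forall>w\<in>V. \<exists>s\<in>S. w \<in> simplex_vertices s)"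

definition star :: "'a set set \<Rightarrow> 'a \<Rightarrow> 'a set set" where
  "star S w = {s \<in> S. w \<in> s}"

text \<open>A star may contain infinitely many simplices even if the vertex set is locally finite,
  so its volume is a sum in the extended nonnegative reals.\<close>

definition star_vol :: "'a::euclidean_space set set \<Rightarrow> 'a \<Rightarrow> ennreal" where
  "star_vol S w = (\<Sum>\<^sub>\<infinity>s\<in>star S w. emeasure lebesgue s)"


subsection \<open>Continuous piecewise-linear functions\<close>

text \<open>Functions on \<open>convex hull V\<close> are represented by functions on the whole space;
  their values outside \<open>convex hull V\<close> are irrelevant everywhere below.\<close>

definition cpwl :: "'a::euclidean_space set \<Rightarrow> 'a set set \<Rightarrow> ('a \<Rightarrow> complex) set" where
  "cpwl V S = {f. continuous_on (convex hull V) f \<and>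
                  (\<forall>s\<in>S. \<exists>g. affine_function g \<and> (\<forall>x\<in>s. f x = g x))}"

definition vertex_coord :: "'a::euclidean_space set \<Rightarrow> 'a \<Rightarrow> 'a \<Rightarrow> real" where
  "vertex_coord s w = (THE f. affine_function f \<and> f w = 1 \<and>
                              (\<forall>u\<in>simplex_vertices s - {w}. f u = 0))"

text \<open>The value at a point is the one prescribed by every simplex containing it; for a full
  triangulation and a vertex \<open>w\<close> these prescriptions agree, because simplices meet in common
  faces. Continuity of \<open>hat S w\<close> is not automatic, however: infinitely many simplices may
  accumulate at a point of \<open>convex hull V\<close> that none of them contains.\<close>

definition hat :: "'a::euclidean_space set set \<Rightarrow> 'a \<Rightarrow> 'a \<Rightarrow> real" where
  "hat S w x = (THE y. \<forall>s\<in>S. x \<in> s \<longrightarrow> y = (if s \<in> star S w then vertex_coord s w x else 0))"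


subsection \<open>Square-integrable functions and square-summable sequences\<close>

definition L2_norm :: "'a measure \<Rightarrow> ('a \<Rightarrow> 'b::real_normed_vector) \<Rightarrow> ennreal" where
  "L2_norm M f = (let J = \<integral>\<^sup>+ x. ennreal ((norm (f x))\<^sup>2) \<partial>M
                  in if J = \<infinity> then \<infinity> else ennreal (sqrt (enn2real J)))"

definition L2 :: "'a measure \<Rightarrow> ('a \<Rightarrow> complex) set" where
  "L2 M = {f \<in> borel_measurable M. L2_norm M f < \<infinity>}"

definition ell2 :: "nat set \<Rightarrow> (nat \<Rightarrow> complex) set" where
  "ell2 I = {c. (\<lambda>k. (cmod (c k))\<^sup>2) summable_on I}"

definition ell2_norm :: "nat set \<Rightarrow> (nat \<Rightarrow> complex) \<Rightarrow> real" where
  "ell2_norm I c = sqrt (\<Sum>\<^sub>\<infinity>k\<in>I. (cmod (c k))\<^sup>2)"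


subsection \<open>Riesz bases\<close>

text \<open>\<open>f\<close> is the sum of \<open>\<phi> k\<close> over \<open>k \<in> I\<close>, with convergence in the norm of \<open>L2 M\<close>.\<close>

definition L2_has_sum ::
    "'a measure \<Rightarrow> nat set \<Rightarrow> (nat \<Rightarrow> 'a \<Rightarrow> complex) \<Rightarrow> ('a \<Rightarrow> complex) \<Rightarrow> bool" where
  "L2_has_sum M I \<phi> f \<longleftrightarrow> f \<in> L2 M \<and>
     ((\<lambda>F. L2_norm M (\<lambda>x. (\<Sum>k\<in>F. \<phi> k x) - f x)) \<longlongrightarrow> 0) (finite_subsets_at_top I)"

definition fun_span :: "nat set \<Rightarrow> (nat \<Rightarrow> 'a \<Rightarrow> complex) \<Rightarrow> ('a \<Rightarrow> complex) set" where
  "fun_span I \<phi> = {\<lambda>x. \<Sum>k\<in>F. c k * \<phi> k x | F c. finite F \<and> F \<subseteq> I}"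

definition L2_closure :: "'a measure \<Rightarrow> ('a \<Rightarrow> complex) set \<Rightarrow> ('a \<Rightarrow> complex) set" where
  "L2_closure M G = {f \<in> L2 M. \<forall>e>0. \<exists>g\<in>G. L2_norm M (\<lambda>x. f x - g x) < e}"

text \<open>Elements of \<open>L2 M\<close> are functions rather than classes modulo null sets, so a set of functions
  has to be saturated under almost-everywhere equality before it is compared with a closure.\<close>

definition L2_classes :: "'a measure \<Rightarrow> ('a \<Rightarrow> complex) set \<Rightarrow> ('a \<Rightarrow> complex) set" where
  "L2_classes M H = {f \<in> L2 M. \<exists>h\<in>H. AE x in M. f x = h x}"

definition riesz_inequality ::
    "'a measure \<Rightarrow> nat set \<Rightarrow> (nat \<Rightarrow> 'a \<Rightarrow> complex) \<Rightarrow> real \<Rightarrow> real \<Rightarrow> bool" where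
  "riesz_inequality M I \<phi> A B \<longleftrightarrow>
     (\<forall>c\<in>ell2 I. \<exists>f. L2_has_sum M I (\<lambda>k x. c k * \<phi> k x) f \<and>
        ennreal (A * ell2_norm I c) \<le> L2_norm M f \<and>
        L2_norm M f \<le> ennreal (B * ell2_norm I c))"

definition riesz_basis ::
    "'a measure \<Rightarrow> nat set \<Rightarrow> (nat \<Rightarrow> 'a \<Rightarrow> complex) \<Rightarrow> ('a \<Rightarrow> complex) set \<Rightarrow> bool" where
  "riesz_basis M I \<phi> H \<longleftrightarrow>
     (\<forall>k\<in>I. \<phi> k \<in> H) \<and>
     L2_closure M (fun_span I \<phi>) = L2_classes M H \<and>
     (\<exists>A B. 0 < A \<and> A \<le> B \<and> riesz_inequality M I \<phi> A B)"

definition riesz_lower_bound :: "'a measure \<Rightarrow> nat set \<Rightarrow> (nat \<Rightarrow> 'a \<Rightarrow> complex) \<Rightarrow> real" where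
  "riesz_lower_bound M I \<phi> = Sup {A. 0 < A \<and> (\<exists>B\<ge>A. riesz_inequality M I \<phi> A B)}"

definition riesz_upper_bound :: "'a measure \<Rightarrow> nat set \<Rightarrow> (nat \<Rightarrow> 'a \<Rightarrow> complex) \<Rightarrow> real" where
  "riesz_upper_bound M I \<phi> = Inf {B. \<exists>A. 0 < A \<and> A \<le> B \<and> riesz_inequality M I \<phi> A B}"

definition riesz_condition_number ::
    "'a measure \<Rightarrow> nat set \<Rightarrow> (nat \<Rightarrow> 'a \<Rightarrow> complex) \<Rightarrow> real" where
  "riesz_condition_number M I \<phi> = riesz_upper_bound M I \<phi> / riesz_lower_bound M I \<phi>"

end

theory Submission
  imports Defs
begin

text \<open>
  Let \<open>s\<close> be a \<open>d\<close>-simplex with barycentric coordinates \<open>\<lambda>\<^sub>w\<close>. The points of \<open>s\<close> with \<open>\<lambda>\<^sub>u \<ge> t\<close>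
  are a copy of \<open>s\<close> shrunk by the factor \<open>1 - t\<close> towards \<open>u\<close>, so slicing along \<open>\<lambda>\<^sub>u\<close> evaluates
  the integral of \<open>\<lambda>\<^sub>u \<lambda>\<^sub>w\<close> over \<open>s\<close>: it is \<open>vol(s) / ((d+1)(d+2))\<close>, and twice that if \<open>u = w\<close>.
  An affine function with vertex values \<open>c\<^sub>w\<close> therefore has the squared norm
  \<open>vol(s) / ((d+1)(d+2)) * (\<Sum> \<bar>c\<^sub>w\<bar>\<^sup>2 + \<bar>\<Sum> c\<^sub>w\<bar>\<^sup>2)\<close> on \<open>s\<close> (\<open>integral_affine_square\<close>). By Cauchy-Schwarz
  for the \<open>d+1\<close> vertices this lies between \<open>vol(s) / ((d+1)(d+2))\<close> and \<open>vol(s) / (d+1)\<close> times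
  \<open>\<Sum> \<bar>c\<^sub>w\<bar>\<^sup>2\<close>.

  Distinct simplices overlap in null sets. Summing over the simplices, and collecting the terms
  that belong to one vertex, replaces \<open>vol(s)\<close> by \<open>vol(St(w))\<close> as the weight of \<open>\<bar>c\<^sub>w\<bar>\<^sup>2\<close>
  (\<open>energy_ge_star_weighted\<close>, \<open>energy_le_star_weighted\<close>); for a single hat function the sum is exact,
  with the value \<open>2 vol(St(w)) / ((d+1)(d+2))\<close> (\<open>energy_hat\<close>). Everything quantitative follows: (ii) and
  (iii) are the same condition up to an increasing bijection of the extended half-line, (ii) gives
  the Riesz inequality with the stated constants, and the Riesz inequality on unit sequences gives
  back (iii).

  What remains is that the closed span of the hat functions is the space of square-integrable
  continuous piecewise-linear functions. Such a function is the interpolant of its vertex values,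
  which are square-summable by the lower bound, so it is the \<open>L2\<close> limit of its partial sums
  (\<open>cpwl_class_in_closure\<close>). Conversely, if finite combinations converge in \<open>L2\<close>, the lower bound
  makes their coefficients Cauchy, uniformly in the vertex. The value of an interpolant is a convex
  combination of vertex values, so the combinations converge uniformly, and a uniform limit of
  continuous functions is continuous even where infinitely many simplices accumulate
  (\<open>closure_in_cpwl_class\<close>).
\<close>


section \<open>Barycentric coordinates\<close>

lemma affine_function_affine_combination:
  assumes f: "affine_function f" and u: "sum u C = 1"
  shows "f (\<Sum>x\<in>C. u x *\<^sub>R x) = (\<Sum>x\<in>C. u x *\<^sub>R f x)"
proof -
  obtain g b where g: "linear g" and fg: "f = (\<lambda>x. g x + b)"
    using f unfolding affine_function_def by blast
  have "(\<Sum>x\<in>C. u x *\<^sub>R f x) = (\<Sum>x\<in>C. u x *\<^sub>R g x) + sum u C *\<^sub>R b"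
    by (simp add: fg scaleR_add_right sum.distrib scaleR_sum_left)
  then show ?thesis
    by (simp add: fg u linear_sum[OF g] linear_cmul[OF g])
qed

lemma affine_function_homothety:
  assumes "affine_function f"
  shows "f (t *\<^sub>R u + (1 - t) *\<^sub>R x) = t *\<^sub>R f u + (1 - t) *\<^sub>R f x"
proof -
  obtain g b where g: "linear g" and fg: "f = (\<lambda>x. g x + b)"
    using assms unfolding affine_function_def by blast
  show ?thesis
    by (simp add: fg linear_add[OF g] linear_diff[OF g] linear_cmul[OF g] algebra_simps)
qed

lemma affine_function_continuous:
  fixes f :: "'a::euclidean_space \<Rightarrow> 'b::real_normed_vector"
  assumes "affine_function f"
  shows "continuous_on T f"
proof -
  obtain g b where g: "linear g" and fg: "f = (\<lambda>x. g x + b)"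
    using assms unfolding affine_function_def by blast
  show ?thesis
    unfolding fg by (intro continuous_intros linear_continuous_on linear_conv_bounded_linear[THEN iffD1] g)
qed

text \<open>The target type changes from real to complex here: barycentric coordinates are real, the
  coefficients of an interpolant are not.\<close>

lemma affine_function_sum_cmult:
  fixes c :: "'w \<Rightarrow> complex" and f :: "'w \<Rightarrow> 'a::real_vector \<Rightarrow> real"
  assumes "\<And>w. w \<in> C \<Longrightarrow> affine_function (f w)"
  shows "affine_function (\<lambda>x. \<Sum>w\<in>C. c w * complex_of_real (f w x))"
proof -
  have "\<forall>w\<in>C. \<exists>g b. linear g \<and> f w = (\<lambda>x. g x + b)"
    using assms unfolding affine_function_def by blast
  then obtain g b where g: "\<And>w. w \<in> C \<Longrightarrow> linear (g w)" and fg: "\<And>w. w \<in> C \<Longrightarrow> f w = (\<lambda>x. g w x + b w)"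
    by metis
  have "linear (\<lambda>x. \<Sum>w\<in>C. c w * complex_of_real (g w x))"
    by (rule linearI)
       (simp_all add: linear_add[OF g] linear_cmul[OF g] algebra_simps sum.distrib scaleR_conv_of_real sum_distrib_left)
  moreover have "(\<lambda>x. \<Sum>w\<in>C. c w * complex_of_real (f w x)) =
      (\<lambda>x. (\<Sum>w\<in>C. c w * complex_of_real (g w x)) + (\<Sum>w\<in>C. c w * complex_of_real (b w)))"
    by (simp add: fg algebra_simps sum.distrib)
  ultimately show ?thesis
    unfolding affine_function_def by blast
qed

locale full_dim_simplex =
  fixes C :: "'a::euclidean_space set"
  assumes independent: "\<not> affine_dependent C"
    and card_vertices: "card C = DIM('a) + 1"
begin

abbreviation bary :: "'a \<Rightarrow> 'a \<Rightarrow> real" where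
  "bary \<equiv> vertex_coord (convex hull C)"

lemma finite_vertices: "finite C"
  using independent by (rule aff_independent_finite)

lemma affine_hull_vertices: "affine hull C = UNIV"
  using independent card_vertices by (intro affine_independent_span_eq) auto

lemma affine_combination_ex:
  obtains u where "sum u C = 1" "(\<Sum>v\<in>C. u v *\<^sub>R v) = x"
proof -
  have "x \<in> {y. \<exists>u. sum u C = 1 \<and> (\<Sum>v\<in>C. u v *\<^sub>R v) = y}"
    using affine_hull_finite[OF finite_vertices] affine_hull_vertices by auto
  then show ?thesis using that by blast
qed

lemma affine_function_eqI:
  assumes "affine_function f" "affine_function g" "\<And>w. w \<in> C \<Longrightarrow> f w = g w"
  shows "f = g"
proof
  fix x
  obtain u where u: "sum u C = 1" "(\<Sum>v\<in>C. u v *\<^sub>R v) = x"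
    by (rule affine_combination_ex)
  show "f x = g x"
    using affine_function_affine_combination[OF assms(1) u(1)]
      affine_function_affine_combination[OF assms(2) u(1)] assms(3) u(2) by simp
qed

text \<open>The vectors from \<open>w\<close> to the other vertices form a basis, so a linear map can take the value
  \<open>- 1\<close> on all of them; shifted to be \<open>1\<close> at \<open>w\<close>, it vanishes at the other vertices.\<close>

lemma bary_ex:
  assumes w: "w \<in> C"
  shows "\<exists>f::'a\<Rightarrow>real. affine_function f \<and> f w = 1 \<and> (\<forall>u\<in>C - {w}. f u = 0)"
proof -
  have "independent ((\<lambda>x. - w + x) ` (C - {w}))"
    using affine_dependent_iff_dependent2[OF w] independent by blast
  then obtain g :: "'a \<Rightarrow> real" where g: "linear g" "\<forall>y\<in>(\<lambda>x. - w + x) ` (C - {w}). g y = - 1"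
    using linear_independent_extend[where f = "\<lambda>_. - 1 :: real"] by blast
  have "g u = g w - 1" if "u \<in> C - {w}" for u
  proof -
    have "g (- w + u) = - 1" using g(2) that by blast
    then show ?thesis by (simp add: linear_diff[OF g(1)])
  qed
  then show ?thesis
    unfolding affine_function_def using g(1)
    by (intro exI[of _ "\<lambda>x. g x + (1 - g w)"]) auto
qed

lemma bary_props:
  assumes w: "w \<in> C"
  shows "affine_function (bary w)" "bary w w = 1" "\<And>u. u \<in> C \<Longrightarrow> u \<noteq> w \<Longrightarrow> bary w u = 0"
proof -
  have "\<exists>!f::'a\<Rightarrow>real. affine_function f \<and> f w = 1 \<and> (\<forall>u\<in>simplex_vertices (convex hull C) - {w}. f u = 0)"
    unfolding simplex_vertices_convex_hull[OF independent]
    using bary_ex[OF w] affine_function_eqI by (metis (lifting) DiffI singletonD)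
  from theI'[OF this, folded vertex_coord_def]
  show "affine_function (bary w)" "bary w w = 1" "\<And>u. u \<in> C \<Longrightarrow> u \<noteq> w \<Longrightarrow> bary w u = 0"
    unfolding simplex_vertices_convex_hull[OF independent] by auto
qed

lemma bary_affine_combination:
  assumes "w \<in> C" "sum u C = 1"
  shows "bary w (\<Sum>v\<in>C. u v *\<^sub>R v) = u w"
proof -
  have "bary w (\<Sum>v\<in>C. u v *\<^sub>R v) = (\<Sum>v\<in>C. u v * bary w v)"
    using affine_function_affine_combination[OF bary_props(1)[OF assms(1)] assms(2)] by simp
  also have "\<dots> = (\<Sum>v\<in>C. if v = w then u w else 0)"
    using bary_props[OF assms(1)] by (intro sum.cong) auto
  finally show ?thesis
    using finite_vertices assms(1) by simp
qed

lemma bary_sum: "(\<Sum>w\<in>C. bary w x) = 1"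
  and bary_combination: "(\<Sum>w\<in>C. bary w x *\<^sub>R w) = x"
proof -
  obtain u where u: "sum u C = 1" "(\<Sum>v\<in>C. u v *\<^sub>R v) = x"
    by (rule affine_combination_ex)
  have "\<And>w. w \<in> C \<Longrightarrow> bary w x = u w"
    using bary_affine_combination u by blast
  then show "(\<Sum>w\<in>C. bary w x) = 1" "(\<Sum>w\<in>C. bary w x *\<^sub>R w) = x"
    using u by auto
qed

lemma affine_function_bary:
  assumes "affine_function f"
  shows "f x = (\<Sum>w\<in>C. bary w x *\<^sub>R f w)"
  using affine_function_affine_combination[OF assms bary_sum] bary_combination by metis

text \<open>A face is described by signs and zeros of barycentric coordinates alone. In
  particular a face contains no vertex of the simplex besides its own.\<close>

lemma mem_hull_subset_iff:
  assumes "W \<subseteq> C"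
  shows "x \<in> convex hull W \<longleftrightarrow> (\<forall>w\<in>C. 0 \<le> bary w x) \<and> (\<forall>w\<in>C - W. bary w x = 0)"
proof
  assume "x \<in> convex hull W"
  then obtain u where u: "\<forall>x\<in>W. 0 \<le> u x" "sum u W = 1" "(\<Sum>v\<in>W. u v *\<^sub>R v) = x"
    using convex_hull_finite[OF finite_subset[OF assms finite_vertices]] by auto
  define u' where "u' v = (if v \<in> W then u v else 0)" for v
  have 1: "sum u' C = 1"
    unfolding u'_def using u(2) assms finite_vertices
    by (simp add: sum.If_cases Int_absorb1)
  have "(\<Sum>v\<in>C. u' v *\<^sub>R v) = (\<Sum>v\<in>W. u v *\<^sub>R v)"
    by (rule sum.mono_neutral_cong_right) (use assms finite_vertices in \<open>auto simp: u'_def\<close>)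
  with u(3) have "(\<Sum>v\<in>C. u' v *\<^sub>R v) = x" by simp
  then have "\<And>w. w \<in> C \<Longrightarrow> bary w x = u' w"
    using bary_affine_combination[OF _ 1] by blast
  then show "(\<forall>w\<in>C. 0 \<le> bary w x) \<and> (\<forall>w\<in>C - W. bary w x = 0)"
    using u(1) by (auto simp: u'_def)
next
  assume *: "(\<forall>w\<in>C. 0 \<le> bary w x) \<and> (\<forall>w\<in>C - W. bary w x = 0)"
  have "sum (\<lambda>w. bary w x) W = sum (\<lambda>w. bary w x) C"
    "(\<Sum>w\<in>W. bary w x *\<^sub>R w) = (\<Sum>w\<in>C. bary w x *\<^sub>R w)"
    using * assms finite_vertices by (auto intro!: sum.mono_neutral_left)
  then show "x \<in> convex hull W"
    unfolding convex_hull_finite[OF finite_subset[OF assms finite_vertices]]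
    using * assms bary_sum[of x] bary_combination[of x]
    by (intro CollectI exI[of _ "\<lambda>w. bary w x"]) auto
qed

lemma mem_simplex_iff: "x \<in> convex hull C \<longleftrightarrow> (\<forall>w\<in>C. 0 \<le> bary w x)"
  using mem_hull_subset_iff[of C] by simp

lemma bary_le_1: "x \<in> convex hull C \<Longrightarrow> w \<in> C \<Longrightarrow> bary w x \<le> 1"
  using bary_sum[of x] member_le_sum[of w C "\<lambda>w. bary w x"] finite_vertices
  by (simp add: mem_simplex_iff)

lemma bary_measurable [measurable]: "w \<in> C \<Longrightarrow> bary w \<in> borel_measurable borel"
  by (intro borel_measurable_continuous_onI affine_function_continuous bary_props)

lemma simplex_borel [measurable]: "convex hull C \<in> sets borel"
  using finite_vertices by (intro borel_closed compact_imp_closed compact_convex_hull finite_imp_compact)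

lemma volume_eq: "emeasure lborel (convex hull C) = ennreal (measure lborel (convex hull C))"
proof (rule emeasure_eq_ennreal_measure)
  have "bounded (convex hull C)"
    using finite_vertices by (intro compact_imp_bounded compact_convex_hull finite_imp_compact)
  then show "emeasure lborel (convex hull C) \<noteq> top"
    using emeasure_bounded_finite by (simp add: less_top)
qed

text \<open>The image of the simplex under the contraction \<open>y \<mapsto> t u + (1 - t) y\<close> is the slice where the
  coordinate of \<open>u\<close> is at least \<open>t\<close>: the contraction multiplies all coordinates by \<open>1 - t\<close> and
  adds \<open>t\<close> to that of \<open>u\<close>.\<close>

lemma homothety_mem_iff:
  assumes u: "u \<in> C" and t: "t < 1" "0 \<le> t"
  shows "y \<in> convex hull C \<longleftrightarrow>
     t *\<^sub>R u + (1 - t) *\<^sub>R y \<in> convex hull C \<and> t \<le> bary u (t *\<^sub>R u + (1 - t) *\<^sub>R y)"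
proof -
  have *: "bary w (t *\<^sub>R u + (1 - t) *\<^sub>R y) = (if w = u then t else 0) + (1 - t) * bary w y" if "w \<in> C" for w
    using affine_function_homothety[OF bary_props(1)[OF that]] bary_props(2,3)[OF that] u by auto
  have "(\<forall>w\<in>C. 0 \<le> bary w y) \<longleftrightarrow> (\<forall>w\<in>C. (if w = u then t else 0) \<le> (if w = u then t else 0) + (1 - t) * bary w y)"
    using t by (auto simp: zero_le_mult_iff)
  also have "\<dots> \<longleftrightarrow> (\<forall>w\<in>C. 0 \<le> (if w = u then t else 0) + (1 - t) * bary w y) \<and> t \<le> t + (1 - t) * bary u y"
    using t u by (smt (verit))
  finally show ?thesis
    using * u unfolding mem_simplex_iff by simp
qed

text \<open>Layer-cake integration along the coordinate of \<open>u\<close>. The layers are homothetic copies of the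
  simplex, so only translation and scaling of Lebesgue measure enter.\<close>

lemma integral_bary_layers:
  assumes u: "u \<in> C" and g [measurable]: "g \<in> borel_measurable borel"
  shows "(\<integral>\<^sup>+x. ennreal (bary u x) * g x * indicator (convex hull C) x \<partial>lborel) =
    (\<integral>\<^sup>+t. ennreal ((1 - t) ^ DIM('a)) *
       (\<integral>\<^sup>+y. g (t *\<^sub>R u + (1 - t) *\<^sub>R y) * indicator (convex hull C) y \<partial>lborel) * indicator {0..1} t \<partial>lborel)"
proof -
  note bary_measurable[OF u, measurable]
  let ?s = "convex hull C"
  \<comment> \<open>the factor \<open>{0..<1}\<close> drops the null layer \<open>t = 1\<close>, where the homothety degenerates\<close>
  have layer: "ennreal (bary u x) * g x * indicator ?s x =
     (\<integral>\<^sup>+t. indicator {0..bary u x} t * (indicator {0..<1} t * (g x * indicator ?s x)) \<partial>lborel)" for x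
  proof (cases "x \<in> ?s")
    case True
    then have b: "0 \<le> bary u x" "bary u x \<le> 1"
      using u bary_le_1 by (auto simp: mem_simplex_iff)
    have "(\<integral>\<^sup>+t. indicator {0..bary u x} t * (indicator {0..<1} t * (g x * indicator ?s x)) \<partial>lborel)
       = (\<integral>\<^sup>+t. g x * indicator {0..bary u x} t \<partial>lborel)"
      using AE_lborel_singleton[of "1::real"] b True
      by (intro nn_integral_cong_AE) (auto elim!: eventually_mono simp: indicator_def)
    also have "\<dots> = g x * ennreal (bary u x)"
      using b by (simp add: nn_integral_cmult)
    finally show ?thesis using True by (simp add: mult.commute)
  qed auto
  have inner: "(\<integral>\<^sup>+x. indicator {0..bary u x} t * (indicator {0..<1} t * (g x * indicator ?s x)) \<partial>lborel)
     = ennreal ((1 - t) ^ DIM('a)) *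
       (\<integral>\<^sup>+y. g (t *\<^sub>R u + (1 - t) *\<^sub>R y) * indicator ?s y \<partial>lborel) * indicator {0..<1} t" for t :: real
  proof (cases "t \<in> {0..<1}")
    case True
    then have t: "0 \<le> t" "t < 1" by auto
    have "(\<integral>\<^sup>+x. indicator {0..bary u x} t * (indicator {0..<1} t * (g x * indicator ?s x)) \<partial>lborel)
      = (\<integral>\<^sup>+x. indicator {t..} (bary u x) * (g x * indicator ?s x) \<partial>lborel)"
      using t by (intro nn_integral_cong) (auto simp: indicator_def)
    also have "\<dots> = (\<integral>\<^sup>+x. indicator {t..} (bary u x) * (g x * indicator ?s x)
        \<partial>density (distr lborel borel (\<lambda>y. t *\<^sub>R u + (1 - t) *\<^sub>R y)) (\<lambda>_. \<bar>1 - t\<bar> ^ DIM('a)))"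
      using lborel_affine[of "1 - t" "t *\<^sub>R u"] t by simp
    also have "\<dots> = (\<integral>\<^sup>+y. ennreal ((1 - t) ^ DIM('a)) * (g (t *\<^sub>R u + (1 - t) *\<^sub>R y) * indicator ?s y) \<partial>lborel)"
    proof (subst nn_integral_density)
      show "(\<integral>\<^sup>+x. ennreal (\<bar>1 - t\<bar> ^ DIM('a)) * (indicator {t..} (bary u x) * (g x * indicator ?s x))
          \<partial>distr lborel borel (\<lambda>y. t *\<^sub>R u + (1 - t) *\<^sub>R y)) =
        (\<integral>\<^sup>+y. ennreal ((1 - t) ^ DIM('a)) * (g (t *\<^sub>R u + (1 - t) *\<^sub>R y) * indicator ?s y) \<partial>lborel)"
      proof (subst nn_integral_distr)
        show "(\<integral>\<^sup>+y. ennreal (\<bar>1 - t\<bar> ^ DIM('a)) * (indicator {t..} (bary u (t *\<^sub>R u + (1 - t) *\<^sub>R y)) *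
              (g (t *\<^sub>R u + (1 - t) *\<^sub>R y) * indicator ?s (t *\<^sub>R u + (1 - t) *\<^sub>R y))) \<partial>lborel) =
          (\<integral>\<^sup>+y. ennreal ((1 - t) ^ DIM('a)) * (g (t *\<^sub>R u + (1 - t) *\<^sub>R y) * indicator ?s y) \<partial>lborel)"
        proof (rule nn_integral_cong)
          fix y
          show "ennreal (\<bar>1 - t\<bar> ^ DIM('a)) * (indicator {t..} (bary u (t *\<^sub>R u + (1 - t) *\<^sub>R y)) *
              (g (t *\<^sub>R u + (1 - t) *\<^sub>R y) * indicator ?s (t *\<^sub>R u + (1 - t) *\<^sub>R y))) =
            ennreal ((1 - t) ^ DIM('a)) * (g (t *\<^sub>R u + (1 - t) *\<^sub>R y) * indicator ?s y)"
            using t homothety_mem_iff[OF u t(2) t(1), of y] by (cases "y \<in> ?s") (auto simp: indicator_def)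
        qed
      qed measurable
    qed measurable
    also have "\<dots> = ennreal ((1 - t) ^ DIM('a)) * (\<integral>\<^sup>+y. g (t *\<^sub>R u + (1 - t) *\<^sub>R y) * indicator ?s y \<partial>lborel)"
      by (rule nn_integral_cmult) measurable
    finally show ?thesis using True by simp
  qed auto
  have "(\<integral>\<^sup>+x. ennreal (bary u x) * g x * indicator ?s x \<partial>lborel) =
    (\<integral>\<^sup>+x. \<integral>\<^sup>+t. indicator {0..bary u x} t * (indicator {0..<1} t * (g x * indicator ?s x)) \<partial>lborel \<partial>lborel)"
    by (simp add: layer)
  also have "\<dots> = (\<integral>\<^sup>+t. \<integral>\<^sup>+x. indicator {0..bary u x} t * (indicator {0..<1} t * (g x * indicator ?s x)) \<partial>lborel \<partial>lborel)"
  proof (rule lborel_pair.Fubini')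
    have "(\<lambda>p. indicator {p. 0 \<le> fst p \<and> fst p \<le> bary u (snd p)} p * (indicator {0..<1} (fst p) * (g (snd p) * indicator ?s (snd p))))
      \<in> borel_measurable (lborel \<Otimes>\<^sub>M lborel)"
      by measurable
    then show "(\<lambda>(t, x). indicator {0..bary u x} t * (indicator {0..<1} t * (g x * indicator ?s x)))
      \<in> borel_measurable (lborel \<Otimes>\<^sub>M lborel)"
      by (rule measurable_cong[THEN iffD1, rotated]) (auto simp: indicator_def)
  qed
  also have "\<dots> = (\<integral>\<^sup>+t. ennreal ((1 - t) ^ DIM('a)) *
       (\<integral>\<^sup>+y. g (t *\<^sub>R u + (1 - t) *\<^sub>R y) * indicator ?s y \<partial>lborel) * indicator {0..1} t \<partial>lborel)"
    unfolding inner
    using AE_lborel_singleton[of "1::real"]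
    by (intro nn_integral_cong_AE) (auto elim!: eventually_mono simp: indicator_def)
  finally show ?thesis .
qed

end


section \<open>Integrals of products of barycentric coordinates\<close>

text \<open>The two powers of \<open>1 - t\<close> that arise when the integrand of a layer is itself affine in \<open>t\<close>.\<close>

lemma nn_integral_one_minus_powers:
  fixes a b :: real
  assumes nonneg: "\<And>t. 0 \<le> t \<Longrightarrow> t \<le> 1 \<Longrightarrow> 0 \<le> a + b * (1 - t)"
  shows "(\<integral>\<^sup>+t. ennreal ((1 - t) ^ n * (a + b * (1 - t))) * indicator {0..1} t \<partial>lborel)
    = ennreal (a / (real n + 1) + b / (real n + 2))"
proof -
  define P where "P m t = - ((1 - t) ^ Suc m) / real (Suc m)" for m and t :: real
  have P: "(P m has_real_derivative (1 - t) ^ m) (at t)" for m t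
    unfolding P_def by (auto intro!: derivative_eq_intros simp del: power_Suc of_nat_Suc)
  have "(\<integral>\<^sup>+t. ennreal ((1 - t) ^ n * (a + b * (1 - t))) * indicator {0..1} t \<partial>lborel)
      = ennreal ((a * P n 1 + b * P (Suc n) 1) - (a * P n 0 + b * P (Suc n) 0))"
  proof (rule nn_integral_FTC_Icc)
    fix t :: real assume t: "t \<in> {0..1}"
    have "((\<lambda>t. a * P n t + b * P (Suc n) t) has_real_derivative a * (1 - t) ^ n + b * (1 - t) ^ Suc n) (at t)"
      by (intro DERIV_add DERIV_cmult P)
    also have "a * (1 - t) ^ n + b * (1 - t) ^ Suc n = (1 - t) ^ n * (a + b * (1 - t))"
      by (simp add: algebra_simps)
    finally show "((\<lambda>t. a * P n t + b * P (Suc n) t) has_real_derivative (1 - t) ^ n * (a + b * (1 - t))) (at t)" .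
    show "0 \<le> (1 - t) ^ n * (a + b * (1 - t))"
      using t nonneg by simp
  qed auto
  also have "(a * P n 1 + b * P (Suc n) 1) - (a * P n 0 + b * P (Suc n) 0) = a / (real n + 1) + b / (real n + 2)"
    by (simp add: P_def add.commute)
  finally show ?thesis .
qed

context full_dim_simplex begin

abbreviation volume :: real where
  "volume \<equiv> measure lborel (convex hull C)"

lemma integral_bary:
  assumes u: "u \<in> C"
  shows "(\<integral>\<^sup>+x. ennreal (bary u x) * indicator (convex hull C) x \<partial>lborel) = ennreal (volume / (real DIM('a) + 1))"
proof -
  have "(\<integral>\<^sup>+x. ennreal (bary u x) * indicator (convex hull C) x \<partial>lborel)
     = (\<integral>\<^sup>+t. ennreal ((1 - t) ^ DIM('a) * (volume + 0 * (1 - t))) * indicator {0..1} t \<partial>lborel)"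
    using integral_bary_layers[OF u, of "\<lambda>_. 1"]
    by (simp add: volume_eq ennreal_mult'' )
  then show ?thesis
    by (subst (asm) nn_integral_one_minus_powers) simp_all
qed

text \<open>Slicing along the coordinate of \<open>u\<close> turns the coordinate of \<open>w\<close> into
  \<open>\<delta> t + (1 - t) \<lambda>\<^sub>w\<close> with \<open>\<delta> = 1\<close> if \<open>u = w\<close> and \<open>\<delta> = 0\<close> otherwise. The remaining integral over
  the simplex is the first moment, which is known.\<close>

lemma integral_bary_mult:
  assumes u: "u \<in> C" and w: "w \<in> C"
  shows "(\<integral>\<^sup>+x. ennreal (bary u x * bary w x) * indicator (convex hull C) x \<partial>lborel)
    = ennreal ((1 + of_bool (u = w)) * volume / ((real DIM('a) + 1) * (real DIM('a) + 2)))"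
proof -
  note bary_measurable[OF w, measurable]
  let ?\<delta> = "of_bool (u = w) :: real" and ?s = "convex hull C"
  have h: "bary w (t *\<^sub>R u + (1 - t) *\<^sub>R y) = ?\<delta> * t + (1 - t) * bary w y" for t y
    using affine_function_homothety[OF bary_props(1)[OF w]] bary_props(2,3)[OF w] u by auto
  have inner: "(\<integral>\<^sup>+y. ennreal (bary w (t *\<^sub>R u + (1 - t) *\<^sub>R y)) * indicator ?s y \<partial>lborel)
      = ennreal (?\<delta> * volume + (1 / (real DIM('a) + 1) - ?\<delta>) * volume * (1 - t))" if t: "t \<in> {0..1}" for t
  proof -
    have "(\<integral>\<^sup>+y. ennreal (bary w (t *\<^sub>R u + (1 - t) *\<^sub>R y)) * indicator ?s y \<partial>lborel)
      = (\<integral>\<^sup>+y. ennreal (?\<delta> * t) * indicator ?s y + ennreal (1 - t) * (ennreal (bary w y) * indicator ?s y) \<partial>lborel)"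
      unfolding h using t w
      by (intro nn_integral_cong)
         (auto simp: indicator_def mem_simplex_iff ennreal_mult ennreal_plus)
    also have "\<dots> = ennreal (?\<delta> * t) * ennreal volume + ennreal (1 - t) * ennreal (volume / (real DIM('a) + 1))"
      by (simp add: nn_integral_add nn_integral_cmult integral_bary[OF w] volume_eq)
    also have "\<dots> = ennreal (?\<delta> * t * volume + (1 - t) * (volume / (real DIM('a) + 1)))"
      using t by (simp add: ennreal_mult[symmetric] ennreal_plus[symmetric] del: ennreal_plus)
    also have "?\<delta> * t * volume + (1 - t) * (volume / (real DIM('a) + 1))
       = ?\<delta> * volume + (1 / (real DIM('a) + 1) - ?\<delta>) * volume * (1 - t)"
      by (simp add: algebra_simps)
    finally show ?thesis .
  qed
  have "(\<integral>\<^sup>+x. ennreal (bary u x * bary w x) * indicator ?s x \<partial>lborel)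
    = (\<integral>\<^sup>+x. ennreal (bary u x) * ennreal (bary w x) * indicator ?s x \<partial>lborel)"
    using u w by (intro nn_integral_cong) (auto simp: indicator_def mem_simplex_iff ennreal_mult)
  also have "\<dots> = (\<integral>\<^sup>+t. ennreal ((1 - t) ^ DIM('a) * (?\<delta> * volume + (1 / (real DIM('a) + 1) - ?\<delta>) * volume * (1 - t))) * indicator {0..1} t \<partial>lborel)"
  proof -
    have "ennreal ((1 - t) ^ DIM('a)) *
         (\<integral>\<^sup>+y. ennreal (bary w (t *\<^sub>R u + (1 - t) *\<^sub>R y)) * indicator ?s y \<partial>lborel) * indicator {0..1} t
      = ennreal ((1 - t) ^ DIM('a) * (?\<delta> * volume + (1 / (real DIM('a) + 1) - ?\<delta>) * volume * (1 - t))) * indicator {0..1} t" for t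
    proof (cases "t \<in> {0..1}")
      case True
      then have "0 \<le> (1 - t) ^ DIM('a)" by simp
      then show ?thesis by (simp only: inner[OF True] ennreal_mult')
    qed simp
    then show ?thesis
      using integral_bary_layers[OF u, of "\<lambda>x. ennreal (bary w x)"] by simp
  qed
  also have "\<dots> = ennreal (?\<delta> * volume / (real DIM('a) + 1) + (1 / (real DIM('a) + 1) - ?\<delta>) * volume / (real DIM('a) + 2))"
  proof (rule nn_integral_one_minus_powers)
    fix t :: real assume t: "0 \<le> t" "t \<le> 1"
    have "?\<delta> * volume + (1 / (real DIM('a) + 1) - ?\<delta>) * volume * (1 - t)
        = ?\<delta> * t * volume + (1 - t) * (volume / (real DIM('a) + 1))"
      by (simp add: algebra_simps)
    also have "\<dots> \<ge> 0" using t by simp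
    finally show "0 \<le> ?\<delta> * volume + (1 / (real DIM('a) + 1) - ?\<delta>) * volume * (1 - t)" .
  qed
  also have "?\<delta> * volume / (real DIM('a) + 1) + (1 / (real DIM('a) + 1) - ?\<delta>) * volume / (real DIM('a) + 2)
     = (1 + ?\<delta>) * volume / ((real DIM('a) + 1) * (real DIM('a) + 2))"
  proof -
    have "\<delta> * V / (d + 1) + (1 / (d + 1) - \<delta>) * V / (d + 2) = (1 + \<delta>) * V / ((d + 1) * (d + 2))"
      if "0 < d" for d V \<delta> :: real
      using that by (simp add: divide_simps) (simp add: algebra_simps)
    from this[of "real DIM('a)" ?\<delta> volume] show ?thesis by simp
  qed
  finally show ?thesis .
qed

text \<open>The Gram matrix of the barycentric coordinates is a multiple of the identity plus the all-ones
  matrix. The identity contributes \<open>\<Sum> \<bar>c\<^sub>w\<bar>\<^sup>2\<close>, the all-ones matrix \<open>\<bar>\<Sum> c\<^sub>w\<bar>\<^sup>2\<close>.\<close>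

lemma integral_affine_square:
  fixes c :: "'a \<Rightarrow> complex"
  shows "(\<integral>\<^sup>+x. ennreal ((cmod (\<Sum>w\<in>C. c w * bary w x))\<^sup>2) * indicator (convex hull C) x \<partial>lborel)
    = ennreal (volume / ((real DIM('a) + 1) * (real DIM('a) + 2)) * ((\<Sum>w\<in>C. (cmod (c w))\<^sup>2) + (cmod (\<Sum>w\<in>C. c w))\<^sup>2))"
proof -
  let ?s = "convex hull C" and ?K = "volume / ((real DIM('a) + 1) * (real DIM('a) + 2))"
  have sq: "(cmod (\<Sum>w\<in>C. c w * of_real (r w)))\<^sup>2 = (\<Sum>u\<in>C. \<Sum>w\<in>C. Re (c u * cnj (c w)) * (r u * r w))" for r :: "'a \<Rightarrow> real"
  proof -
    have "complex_of_real ((cmod (\<Sum>w\<in>C. c w * of_real (r w)))\<^sup>2) = (\<Sum>u\<in>C. \<Sum>w\<in>C. (c u * cnj (c w)) * of_real (r u * r w))"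
      by (subst complex_norm_square) (simp add: sum_product mult_ac)
    from arg_cong[OF this, of Re] show ?thesis by simp
  qed
  \<comment> \<open>the mixed terms of the square have coefficients of either sign, so the nonnegative integrals
    are passed to Bochner integrals before they are combined\<close>
  have prod: "has_bochner_integral lborel (\<lambda>x. bary u x * bary w x * indicator ?s x) ((1 + of_bool (u = w)) * ?K)"
    if "u \<in> C" "w \<in> C" for u w
  proof (rule has_bochner_integral_nn_integral)
    note bary_measurable[OF that(1), measurable] bary_measurable[OF that(2), measurable]
    show "(\<lambda>x. bary u x * bary w x * indicator ?s x) \<in> borel_measurable lborel"
      by measurable
    show "AE x in lborel. 0 \<le> bary u x * bary w x * indicator ?s x"
      using that by (auto simp: indicator_def mem_simplex_iff)
    show "0 \<le> (1 + of_bool (u = w)) * ?K" by simp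
    show "(\<integral>\<^sup>+x. ennreal (bary u x * bary w x * indicator ?s x) \<partial>lborel) = ennreal ((1 + of_bool (u = w)) * ?K)"
      using integral_bary_mult[OF that] by (simp add: ennreal_indicator[symmetric] ennreal_mult''[symmetric])
  qed
  have "has_bochner_integral lborel (\<lambda>x. \<Sum>u\<in>C. \<Sum>w\<in>C. Re (c u * cnj (c w)) * (bary u x * bary w x * indicator ?s x))
     (\<Sum>u\<in>C. \<Sum>w\<in>C. Re (c u * cnj (c w)) * ((1 + of_bool (u = w)) * ?K))"
    by (intro has_bochner_integral_sum has_bochner_integral_mult_right prod)
  also have "(\<lambda>x. \<Sum>u\<in>C. \<Sum>w\<in>C. Re (c u * cnj (c w)) * (bary u x * bary w x * indicator ?s x))
      = (\<lambda>x. (cmod (\<Sum>w\<in>C. c w * bary w x))\<^sup>2 * indicator ?s x)"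
    unfolding sq sum_distrib_right by (simp add: mult.assoc)
  also have "(\<Sum>u\<in>C. \<Sum>w\<in>C. Re (c u * cnj (c w)) * ((1 + of_bool (u = w)) * ?K))
      = (\<Sum>u\<in>C. \<Sum>w\<in>C. Re (c u * cnj (c w))) * ?K + (\<Sum>u\<in>C. \<Sum>w\<in>C. if u = w then Re (c u * cnj (c w)) * ?K else 0)"
    unfolding sum_distrib_right sum.distrib[symmetric] by (intro sum.cong refl) (simp add: algebra_simps)
  also have "(\<Sum>u\<in>C. \<Sum>w\<in>C. if u = w then Re (c u * cnj (c w)) * ?K else 0) = (\<Sum>u\<in>C. (cmod (c u))\<^sup>2) * ?K"
    using finite_vertices by (simp add: sum_distrib_right sum_divide_distrib complex_mult_cnj cmod_power2)
  also have "(\<Sum>u\<in>C. \<Sum>w\<in>C. Re (c u * cnj (c w))) = (cmod (\<Sum>w\<in>C. c w))\<^sup>2"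
    using sq[of "\<lambda>_. 1"] by simp
  finally have int: "has_bochner_integral lborel (\<lambda>x. (cmod (\<Sum>w\<in>C. c w * bary w x))\<^sup>2 * indicator ?s x)
     (?K * ((\<Sum>w\<in>C. (cmod (c w))\<^sup>2) + (cmod (\<Sum>w\<in>C. c w))\<^sup>2))"
    by (simp only: algebra_simps)
  have "(\<integral>\<^sup>+x. ennreal ((cmod (\<Sum>w\<in>C. c w * bary w x))\<^sup>2) * indicator ?s x \<partial>lborel)
     = (\<integral>\<^sup>+x. ennreal ((cmod (\<Sum>w\<in>C. c w * bary w x))\<^sup>2 * indicator ?s x) \<partial>lborel)"
    by (intro nn_integral_cong) (auto simp: indicator_def)
  also have "\<dots> = ennreal (\<integral>x. (cmod (\<Sum>w\<in>C. c w * bary w x))\<^sup>2 * indicator ?s x \<partial>lborel)"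
    using int by (intro nn_integral_eq_integral) (auto simp: has_bochner_integral_iff)
  finally show ?thesis
    using int by (simp add: has_bochner_integral_iff)
qed

end


section \<open>Sums over countable sets as integrals\<close>

text \<open>Extended nonnegative sums are handled as integrals over counting measure, because exchanging
  them with each other and with Lebesgue integrals is then one instance of Tonelli's theorem.\<close>

lemma nn_integral_count_space_infsum:
  fixes f :: "'b \<Rightarrow> ennreal"
  assumes "countable A"
  shows "(\<integral>\<^sup>+x. f x \<partial>count_space A) = infsum f A"
proof (cases "finite A")
  case True
  then show ?thesis by (simp add: nn_integral_count_space_finite)
next
  case False
  let ?e = "from_nat_into A"
  have e: "bij_betw ?e UNIV A"
    using bij_betw_from_nat_into[OF assms False] .
  have "(\<integral>\<^sup>+x. f x \<partial>count_space A) = (\<Sum>n. f (?e n))"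
    by (simp add: nn_integral_bij_count_space[OF e, symmetric] nn_integral_count_space_nat)
  also have "\<dots> = infsum (\<lambda>n. f (?e n)) UNIV"
  proof -
    have "(\<lambda>n. f (?e n)) summable_on UNIV"
      by (rule nonneg_summable_on_complete) simp
    then show ?thesis
      by (intro sums_unique[symmetric] has_sum_imp_sums has_sum_infsum)
  qed
  also have "\<dots> = infsum f A"
    by (rule infsum_reindex_bij_betw[OF e])
  finally show ?thesis .
qed


lemma nn_integral_count_space_real:
  fixes f :: "'b \<Rightarrow> real"
  assumes "countable A" "\<And>x. x \<in> A \<Longrightarrow> 0 \<le> f x" "f summable_on A"
  shows "(\<integral>\<^sup>+x. ennreal (f x) \<partial>count_space A) = ennreal (infsum f A)"
proof -
  have "infsum (\<lambda>x. ennreal (f x)) A = (SUP F\<in>{F. finite F \<and> F \<subseteq> A}. \<Sum>x\<in>F. ennreal (f x))"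
    by (rule nonneg_infsum_complete) simp
  also have "\<dots> = (SUP F\<in>{F. finite F \<and> F \<subseteq> A}. ennreal (sum f F))"
    using assms(2) by (intro SUP_cong refl sum_ennreal) auto
  also have "\<dots> = ennreal (infsum f A)"
    by (rule infsum_nonneg_is_SUPREMUM_ennreal[symmetric]) (use assms in auto)
  finally show ?thesis
    using nn_integral_count_space_infsum[OF assms(1)] by metis
qed

lemma summable_on_if_nn_integral_finite:
  fixes f :: "'b \<Rightarrow> real"
  assumes "\<And>x. x \<in> A \<Longrightarrow> 0 \<le> f x" "(\<integral>\<^sup>+x. ennreal (f x) \<partial>count_space A) < \<infinity>"
  shows "f summable_on A"
proof (rule nonneg_bounded_partial_sums_imp_summable_on)
  show "\<forall>\<^sub>F F in finite_subsets_at_top A. sum f F \<le> enn2real (\<integral>\<^sup>+x. ennreal (f x) \<partial>count_space A)"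
  proof (rule eventually_finite_subsets_at_top_weakI)
    fix F assume F: "finite F" "F \<subseteq> A"
    have "ennreal (sum f F) = (\<Sum>x\<in>F. ennreal (f x) * indicator F x)"
      using F assms(1) by (simp add: subset_iff)
    also have "\<dots> = (\<integral>\<^sup>+x. ennreal (f x) * indicator F x \<partial>count_space A)"
      using F by (intro nn_integral_count_space'[symmetric]) auto
    also have "\<dots> \<le> (\<integral>\<^sup>+x. ennreal (f x) \<partial>count_space A)"
      by (intro nn_integral_mono) (auto simp: indicator_def)
    finally show "sum f F \<le> enn2real (\<integral>\<^sup>+x. ennreal (f x) \<partial>count_space A)"
      using assms(2) F assms(1) by (metis enn2real_ennreal enn2real_mono infinity_ennreal_def subsetD sum_nonneg)
  qed
qed (use assms in auto)


section \<open>Hat functions and interpolation on a triangulation\<close>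

locale triangulation =
  fixes V :: "'a::euclidean_space set" and S :: "'a set set"
  assumes countable_vertices: "countable V"
    and full_triangulation: "full_triangulation V S"
begin

abbreviation vert :: "'a set \<Rightarrow> 'a set" where
  "vert \<equiv> simplex_vertices"

lemma
  assumes "s \<in> S"
  shows hull_vert: "convex hull (vert s) = s"
    and full_dim_simplex_vert: "full_dim_simplex (vert s)"
    and vert_subset: "vert s \<subseteq> V"
proof -
  have *: "int DIM('a) simplex s" "vert s \<subseteq> V"
    using full_triangulation assms unfolding full_triangulation_def by auto
  then obtain C where C: "\<not> affine_dependent C" "int (card C) = int DIM('a) + 1" "s = convex hull C"
    unfolding simplex_def by blast
  then have "vert s = C"
    by (simp add: simplex_vertices_convex_hull)
  with C * show "convex hull (vert s) = s" "full_dim_simplex (vert s)" "vert s \<subseteq> V"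
    by (auto simp: full_dim_simplex_def)
qed

lemma finite_vert: "s \<in> S \<Longrightarrow> finite (vert s)"
  by (rule full_dim_simplex.finite_vertices[OF full_dim_simplex_vert])

lemma Union_simplices: "\<Union>S = convex hull V"
  using full_triangulation unfolding full_triangulation_def by blast

lemma mem_hull_obtains:
  assumes "x \<in> convex hull V"
  obtains s where "s \<in> S" "x \<in> s"
proof -
  have "x \<in> \<Union>S" using assms Union_simplices by simp
  then show thesis using that by (elim UnionE)
qed

lemma simplex_subset: "s \<in> S \<Longrightarrow> s \<subseteq> convex hull V"
  using Union_simplices by blast

lemma countable_simplices: "countable S"
proof (rule countable_subset)
  show "S \<subseteq> (\<lambda>F. convex hull F) ` {F. finite F \<and> F \<subseteq> V}"
    using hull_vert vert_subset finite_vert by (metis (mono_tags, lifting) image_eqI mem_Collect_eq subsetI)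
  show "countable ((\<lambda>F. convex hull F) ` {F. finite F \<and> F \<subseteq> V})"
    using countable_Collect_finite_subset[OF countable_vertices] by (simp add: conj_commute)
qed

lemma simplex_borel: "s \<in> S \<Longrightarrow> s \<in> sets borel"
  using full_dim_simplex.simplex_borel[OF full_dim_simplex_vert] hull_vert by simp

lemma hull_borel: "convex hull V \<in> sets borel"
  unfolding Union_simplices[symmetric]
  using countable_simplices simplex_borel by (intro sets.countable_Union) auto

text \<open>The two descriptions of \<open>s \<inter> t\<close>, as a face of \<open>s\<close> and as a face of \<open>t\<close>, use the same
  vertices, since the convex hull of an affinely independent set determines the set.\<close>

lemma intersection_hull:
  assumes s: "s \<in> S" and t: "t \<in> S"
  obtains W where "W \<subseteq> vert s" "W \<subseteq> vert t" "s \<inter> t = convex hull W"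
proof -
  have "simplex_face (s \<inter> t) s" "simplex_face (s \<inter> t) t"
    using full_triangulation s t unfolding full_triangulation_def by blast+
  then obtain W W' where W: "W \<subseteq> vert s" "s \<inter> t = convex hull W"
    and W': "W' \<subseteq> vert t" "s \<inter> t = convex hull W'"
    unfolding simplex_face_def by blast
  have "\<not> affine_dependent W" "\<not> affine_dependent W'"
    using W(1) W'(1) full_dim_simplex.independent[OF full_dim_simplex_vert] s t affine_independent_subset
    by blast+
  then have "W = W'"
    using W(2) W'(2) simplex_vertices_convex_hull by metis
  then show thesis using that W W' by blast
qed

text \<open>A point of \<open>V\<close> cannot lie in a simplex without being one of its vertices: it is a vertex of
  some simplex \<open>t\<close>, hence of each face of \<open>t\<close> that contains it, and \<open>s \<inter> t\<close> is such a face.\<close>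

lemma vertex_mem_simplex_iff:
  assumes w: "w \<in> V" and s: "s \<in> S"
  shows "w \<in> s \<longleftrightarrow> w \<in> vert s"
proof
  assume "w \<in> vert s"
  then show "w \<in> s" using hull_vert[OF s] hull_inc by metis
next
  assume ws: "w \<in> s"
  obtain t where t: "t \<in> S" "w \<in> vert t"
    using full_triangulation w unfolding full_triangulation_def by blast
  interpret T: full_dim_simplex "vert t" by (rule full_dim_simplex_vert[OF t(1)])
  obtain W where W: "W \<subseteq> vert s" "W \<subseteq> vert t" "s \<inter> t = convex hull W"
    using intersection_hull[OF s t(1)] .
  have "w \<in> t" using t hull_vert hull_inc by metis
  with ws W have "w \<in> convex hull W" by blast
  then have "\<forall>u\<in>vert t - W. T.bary u w = 0"
    using T.mem_hull_subset_iff[OF W(2)] by blast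
  then have "w \<in> W"
    using T.bary_props(2)[OF t(2)] t(2) by force
  with W show "w \<in> vert s" by blast
qed

lemma star_eq: "w \<in> V \<Longrightarrow> star S w = {s \<in> S. w \<in> vert s}"
  unfolding star_def using vertex_mem_simplex_iff by blast

text \<open>The value that one simplex prescribes for the hat function at \<open>w\<close>.\<close>

definition local_hat :: "'a set \<Rightarrow> 'a \<Rightarrow> 'a \<Rightarrow> real" where
  "local_hat s w x = (if w \<in> vert s then vertex_coord s w x else 0)"

text \<open>On a face the prescribed value depends only on the convex coordinates with respect to the
  vertices of the face, so it is the same for all simplices with that face.\<close>

lemma local_hat_common_face:
  assumes s: "s \<in> S" and W: "W \<subseteq> vert s" and u: "sum u W = 1" "(\<Sum>v\<in>W. u v *\<^sub>R v) = x"
  shows "local_hat s w x = (\<Sum>v\<in>W. u v * of_bool (v = w))"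
proof -
  interpret full_dim_simplex "vert s" by (rule full_dim_simplex_vert[OF s])
  note h = hull_vert[OF s]
  show ?thesis
  proof (cases "w \<in> vert s")
    case True
    have "local_hat s w x = (\<Sum>v\<in>W. u v * vertex_coord s w v)"
      using affine_function_affine_combination[OF bary_props(1)[OF True] u(1)] u(2) True
      by (simp add: local_hat_def h)
    also have "\<dots> = (\<Sum>v\<in>W. u v * of_bool (v = w))"
      using bary_props(2,3)[OF True] W by (intro sum.cong) (auto simp: h)
    finally show ?thesis .
  next
    case False
    then have "(\<Sum>v\<in>W. u v * of_bool (v = w)) = 0"
      using W by (intro sum.neutral) auto
    with False show ?thesis by (simp add: local_hat_def)
  qed
qed

lemma local_hat_agree:
  assumes "s \<in> S" "t \<in> S" "x \<in> s" "x \<in> t"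
  shows "local_hat s w x = local_hat t w x"
proof -
  obtain W where W: "W \<subseteq> vert s" "W \<subseteq> vert t" "s \<inter> t = convex hull W"
    using intersection_hull assms by metis
  have "finite W" using W(1) finite_vert[OF assms(1)] finite_subset by blast
  then have "x \<in> {y. \<exists>u. (\<forall>v\<in>W. 0 \<le> u v) \<and> sum u W = 1 \<and> (\<Sum>v\<in>W. u v *\<^sub>R v) = y}"
    using W(3) assms convex_hull_finite[of W] by blast
  then have "\<exists>u. (\<forall>v\<in>W. 0 \<le> u v) \<and> sum u W = 1 \<and> (\<Sum>v\<in>W. u v *\<^sub>R v) = x"
    by (rule CollectD)
  then obtain u where u: "sum u W = 1" "(\<Sum>v\<in>W. u v *\<^sub>R v) = x" by blast
  show ?thesis
    using local_hat_common_face[OF assms(1) W(1) u] local_hat_common_face[OF assms(2) W(2) u] by simp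
qed

lemma hat_eq_local:
  assumes w: "w \<in> V" and s: "s \<in> S" "x \<in> s"
  shows "hat S w x = local_hat s w x"
  unfolding hat_def
proof (rule the_equality)
  have star: "t \<in> star S w \<longleftrightarrow> w \<in> vert t" if "t \<in> S" for t
    using star_eq[OF w] that by blast
  show "\<forall>t\<in>S. x \<in> t \<longrightarrow> local_hat s w x = (if t \<in> star S w then vertex_coord t w x else 0)"
    using local_hat_agree[OF s(1) _ s(2)] star by (metis local_hat_def)
  show "\<And>y. \<forall>t\<in>S. x \<in> t \<longrightarrow> y = (if t \<in> star S w then vertex_coord t w x else 0) \<Longrightarrow> y = local_hat s w x"
    using s star by (metis local_hat_def)
qed

text \<open>The series \<open>\<Sum> c\<^sub>w \<beta>\<^sub>w\<close> evaluated pointwise: at each point only the finitely many vertices of a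
  simplex containing it contribute.\<close>

definition interp :: "('a \<Rightarrow> complex) \<Rightarrow> 'a \<Rightarrow> complex" where
  "interp c x = (\<Sum>w | w \<in> V \<and> hat S w x \<noteq> 0. c w * hat S w x)"

lemma interp_on_simplex:
  assumes s: "s \<in> S" "x \<in> s"
  shows "interp c x = (\<Sum>w\<in>vert s. c w * vertex_coord s w x)"
proof -
  have "interp c x = (\<Sum>w\<in>vert s. c w * hat S w x)"
    unfolding interp_def
    by (rule sum.mono_neutral_left)
       (use s finite_vert vert_subset hat_eq_local[OF _ s] in \<open>auto simp: local_hat_def split: if_splits\<close>)
  also have "\<dots> = (\<Sum>w\<in>vert s. c w * vertex_coord s w x)"
    using vert_subset[OF s(1)] hat_eq_local[OF _ s] by (intro sum.cong) (auto simp: local_hat_def)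
  finally show ?thesis .
qed

lemma interp_diff:
  assumes "x \<in> convex hull V"
  shows "interp (\<lambda>w. c w - d w) x = interp c x - interp d x"
proof -
  obtain s where "s \<in> S" "x \<in> s" using assms by (rule mem_hull_obtains)
  then show ?thesis by (simp add: interp_on_simplex sum_subtractf left_diff_distrib)
qed

lemma sum_hat_eq_interp:
  fixes c :: "'a \<Rightarrow> complex"
  assumes x: "x \<in> convex hull V" and F: "finite F" "F \<subseteq> V"
  shows "(\<Sum>w\<in>F. c w * hat S w x) = interp (\<lambda>w. if w \<in> F then c w else 0) x"
proof -
  obtain s where s: "s \<in> S" "x \<in> s" using x by (rule mem_hull_obtains)
  have "interp (\<lambda>w. if w \<in> F then c w else 0) x = (\<Sum>w\<in>vert s. if w \<in> F then c w * vertex_coord s w x else 0)"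
    by (simp add: interp_on_simplex[OF s] if_distrib if_distribR cong: if_cong)
  also have "\<dots> = (\<Sum>w\<in>vert s \<inter> F. c w * vertex_coord s w x)"
    using finite_vert[OF s(1)] by (simp add: sum.inter_restrict)
  also have "\<dots> = (\<Sum>w\<in>F \<inter> vert s. c w * hat S w x)"
    using hat_eq_local[OF _ s] F by (intro sum.cong) (auto simp: local_hat_def)
  also have "\<dots> = (\<Sum>w\<in>F. c w * hat S w x)"
    using hat_eq_local[OF _ s] F by (intro sum.mono_neutral_left) (auto simp: local_hat_def split: if_splits)
  finally show ?thesis ..
qed

lemma hat_eq_interp:
  assumes "x \<in> convex hull V" "w \<in> V"
  shows "complex_of_real (hat S w x) = interp (\<lambda>u. of_bool (u = w)) x"
proof -
  have "(\<lambda>u. of_bool (u = w) :: complex) = (\<lambda>u. if u \<in> {w} then 1 else 0)" by auto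
  then show ?thesis
    using sum_hat_eq_interp[OF assms(1), of "{w}" "\<lambda>_. 1"] assms(2) by simp
qed

lemma cpwl_eq_interp:
  assumes f: "f \<in> cpwl V S" and x: "x \<in> convex hull V"
  shows "f x = interp f x"
proof -
  obtain s where s: "s \<in> S" "x \<in> s" using x by (rule mem_hull_obtains)
  interpret full_dim_simplex "vert s" by (rule full_dim_simplex_vert[OF s(1)])
  note h = hull_vert[OF s(1)]
  obtain g where g: "affine_function g" "\<forall>x\<in>s. f x = g x"
    using f s(1) unfolding cpwl_def by blast
  have "f w = g w" if "w \<in> vert s" for w
    using g(2) that h hull_inc by metis
  then show ?thesis
    using affine_function_bary[OF g(1), of x] g(2) s
    by (simp add: interp_on_simplex[OF s] h scaleR_conv_of_real mult.commute)
qed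

lemma interp_affine:
  assumes s: "s \<in> S"
  shows "\<exists>g. affine_function g \<and> (\<forall>x\<in>s. interp c x = g x)"
proof -
  interpret full_dim_simplex "vert s" by (rule full_dim_simplex_vert[OF s])
  have "affine_function (\<lambda>x. \<Sum>w\<in>vert s. c w * complex_of_real (vertex_coord s w x))"
    using bary_props(1) by (intro affine_function_sum_cmult) (simp add: hull_vert[OF s])
  then show ?thesis using interp_on_simplex[OF s] by blast
qed

text \<open>The value at a point is a convex combination of the coefficients at the vertices of a simplex.
  This bound is what converts convergence of coefficients into uniform convergence.\<close>

lemma norm_interp_le:
  assumes x: "x \<in> convex hull V" and B: "\<And>w. w \<in> V \<Longrightarrow> cmod (c w) \<le> B"
  shows "cmod (interp c x) \<le> B"
proof -
  obtain s where s: "s \<in> S" "x \<in> s" using x by (rule mem_hull_obtains)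
  interpret full_dim_simplex "vert s" by (rule full_dim_simplex_vert[OF s(1)])
  note h = hull_vert[OF s(1)]
  have pos: "0 \<le> vertex_coord s w x" if "w \<in> vert s" for w
    using mem_simplex_iff[of x] that s(2) unfolding h by blast
  have "cmod (interp c x) \<le> (\<Sum>w\<in>vert s. cmod (c w) * vertex_coord s w x)"
    unfolding interp_on_simplex[OF s] by (rule sum_norm_le) (simp add: norm_mult pos)
  also have "\<dots> \<le> (\<Sum>w\<in>vert s. B * vertex_coord s w x)"
    using pos B vert_subset[OF s(1)] by (intro sum_mono mult_right_mono) auto
  also have "\<dots> = B" using bary_sum[of x] unfolding h sum_distrib_left[symmetric] by simp
  finally show ?thesis .
qed

text \<open>Continuity may fail where infinitely many simplices accumulate, but an interpolant is affine
  on each of countably many closed pieces.\<close>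

lemma interp_measurable: "interp c \<in> borel_measurable (lebesgue_on (convex hull V))"
proof (rule measurable_piecewise_restrict[OF countable_simplices])
  fix s assume s: "s \<in> S"
  show "s \<inter> space (lebesgue_on (convex hull V)) \<in> sets (lebesgue_on (convex hull V))"
    using simplex_borel[OF s] simplex_subset[OF s] hull_borel by (auto simp: sets_restrict_space)
  obtain g where g: "affine_function g" "\<And>x. x \<in> s \<Longrightarrow> interp c x = g x"
    using interp_affine[OF s] by blast
  have "g \<in> borel_measurable lebesgue"
    using affine_function_continuous[OF g(1)] by (intro measurable_completion) (simp add: borel_measurable_continuous_onI)
  then have "g \<in> borel_measurable (restrict_space (lebesgue_on (convex hull V)) s)"
    by (intro measurable_restrict_space1)
  then show "interp c \<in> borel_measurable (restrict_space (lebesgue_on (convex hull V)) s)"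
    by (rule measurable_cong[THEN iffD1, rotated]) (simp add: g(2) space_restrict_space)
qed (auto simp: Union_simplices space_restrict_space)

end


section \<open>The squared norm of an interpolant\<close>

context triangulation begin

abbreviation M :: "'a measure" where
  "M \<equiv> lebesgue_on (convex hull V)"

abbreviation vol :: "'a set \<Rightarrow> real" where
  "vol s \<equiv> measure lborel s"

lemma emeasure_simplex: "s \<in> S \<Longrightarrow> emeasure lebesgue s = ennreal (vol s)"
  using full_dim_simplex.volume_eq[OF full_dim_simplex_vert] simplex_borel hull_vert by simp

lemma hull_sets [measurable]: "convex hull V \<in> sets lebesgue"
  using hull_borel by simp

lemma simplex_sets: "s \<in> S \<Longrightarrow> s \<in> sets M"
  using simplex_borel simplex_subset hull_sets by (subst sets_restrict_space_iff) auto

text \<open>A common face with all \<open>d + 1\<close> vertices would force the simplices to coincide; with fewer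
  vertices it has empty interior.\<close>

lemma overlap_null:
  assumes s: "s \<in> S" and t: "t \<in> S" and ne: "s \<noteq> t"
  shows "s \<inter> t \<in> null_sets lebesgue"
proof -
  obtain W where W: "W \<subseteq> vert s" "W \<subseteq> vert t" "s \<inter> t = convex hull W"
    using intersection_hull[OF s t] .
  note card = full_dim_simplex.card_vertices[OF full_dim_simplex_vert]
  have "card W < DIM('a) + 1"
  proof (rule ccontr)
    assume "\<not> card W < DIM('a) + 1"
    then have "card (vert s) \<le> card W" "card (vert t) \<le> card W"
      using card[OF s] card[OF t] by auto
    then have "W = vert s" "W = vert t"
      using W finite_vert s t card_seteq by metis+
    then have "s = t" using hull_vert s t by metis
    with ne show False ..
  qed
  moreover have "finite W" using W(1) finite_vert[OF s] finite_subset by blast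
  ultimately have "interior (s \<inter> t) = {}"
    unfolding W(3) by (intro empty_interior_convex_hull) auto
  then have "negligible (s \<inter> t)"
    using negligible_convex_interior W(3) convex_convex_hull by metis
  then show ?thesis
    by (simp add: negligible_iff_null_sets)
qed

lemma AE_unique_simplex: "AE x in M. \<exists>!s. s \<in> S \<and> x \<in> s"
proof -
  let ?N = "\<Union>s\<in>S. \<Union>t\<in>S - {s}. s \<inter> t"
  have "?N \<in> null_sets lebesgue"
    using overlap_null countable_simplices by (intro null_sets_UN') auto
  then have "AE x in lebesgue. x \<notin> ?N" by (rule AE_not_in)
  then have "AE x in lebesgue. x \<in> convex hull V \<longrightarrow> (\<exists>!s. s \<in> S \<and> x \<in> s)"
  proof (rule eventually_mono, intro impI)
    fix x assume "x \<notin> ?N" "x \<in> convex hull V"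
    moreover obtain s where "s \<in> S" "x \<in> s" using \<open>x \<in> convex hull V\<close> by (rule mem_hull_obtains)
    ultimately show "\<exists>!s. s \<in> S \<and> x \<in> s" by blast
  qed
  then show ?thesis by (subst AE_restrict_space_iff) (auto simp: hull_sets)
qed

lemma nn_integral_simplices:
  assumes g [measurable]: "g \<in> borel_measurable M"
  shows "(\<integral>\<^sup>+x. g x \<partial>M) = (\<integral>\<^sup>+s. (\<integral>\<^sup>+x. g x * indicator s x \<partial>lebesgue) \<partial>count_space S)"
proof -
  have "(\<integral>\<^sup>+x. g x \<partial>M) = (\<integral>\<^sup>+x. \<integral>\<^sup>+s. g x * indicator s x \<partial>count_space S \<partial>M)"
    using AE_unique_simplex
  proof (intro nn_integral_cong_AE, elim eventually_mono)
    fix x assume "\<exists>!s. s \<in> S \<and> x \<in> s"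
    then obtain s where s: "s \<in> S \<and> x \<in> s" "\<forall>t. t \<in> S \<and> x \<in> t \<longrightarrow> t = s"
      by (rule ex1E)
    have "indicator t x = (0 :: ennreal)" if "t \<in> S" "t \<notin> {s}" for t
    proof -
      have "x \<notin> t" using s(2) that by blast
      then show ?thesis by simp
    qed
    then have "(\<integral>\<^sup>+t. g x * indicator t x \<partial>count_space S) = (\<Sum>t\<in>{s}. g x * indicator t x)"
      using conjunct1[OF s(1)] by (intro nn_integral_count_space') simp_all
    then show "g x = (\<integral>\<^sup>+s. g x * indicator s x \<partial>count_space S)"
      using conjunct2[OF s(1)] by simp
  qed
  also have "\<dots> = (\<integral>\<^sup>+s. \<integral>\<^sup>+x. g x * indicator s x \<partial>M \<partial>count_space S)"
    using countable_simplices
    by (intro nn_integral_count_space_nn_integral) (auto intro!: borel_measurable_times_ennreal g borel_measurable_indicator simplex_sets)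
  also have "\<dots> = (\<integral>\<^sup>+s. (\<integral>\<^sup>+x. g x * indicator s x \<partial>lebesgue) \<partial>count_space S)"
  proof (intro nn_integral_cong)
    fix s assume "s \<in> space (count_space S)"
    then have s: "s \<in> S" by simp
    have "(\<integral>\<^sup>+x. g x * indicator s x \<partial>M) = (\<integral>\<^sup>+x. g x * indicator s x * indicator (convex hull V) x \<partial>lebesgue)"
      by (rule nn_integral_restrict_space) (simp add: hull_sets)
    also have "\<dots> = (\<integral>\<^sup>+x. g x * indicator s x \<partial>lebesgue)"
      using simplex_subset[OF s] by (intro nn_integral_cong) (auto simp: indicator_def)
    finally show "(\<integral>\<^sup>+x. g x * indicator s x \<partial>M) = (\<integral>\<^sup>+x. g x * indicator s x \<partial>lebesgue)" .
  qed
  finally show ?thesis .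
qed

definition energy :: "('a \<Rightarrow> complex) \<Rightarrow> ennreal" where
  "energy f = (\<integral>\<^sup>+x. ennreal ((cmod (f x))\<^sup>2) \<partial>M)"

lemma energy_interp:
  "energy (interp c) = (\<integral>\<^sup>+s. ennreal (vol s / ((real DIM('a) + 1) * (real DIM('a) + 2)) *
     ((\<Sum>w\<in>vert s. (cmod (c w))\<^sup>2) + (cmod (\<Sum>w\<in>vert s. c w))\<^sup>2)) \<partial>count_space S)"
  unfolding energy_def
proof (subst nn_integral_simplices)
  show "(\<lambda>x. ennreal ((cmod (interp c x))\<^sup>2)) \<in> borel_measurable M"
    using interp_measurable[of c] by measurable
  show "(\<integral>\<^sup>+s. (\<integral>\<^sup>+x. ennreal ((cmod (interp c x))\<^sup>2) * indicator s x \<partial>lebesgue) \<partial>count_space S) =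
    (\<integral>\<^sup>+s. ennreal (vol s / ((real DIM('a) + 1) * (real DIM('a) + 2)) *
     ((\<Sum>w\<in>vert s. (cmod (c w))\<^sup>2) + (cmod (\<Sum>w\<in>vert s. c w))\<^sup>2)) \<partial>count_space S)"
  proof (intro nn_integral_cong)
    fix s assume "s \<in> space (count_space S)"
    then have s: "s \<in> S" by simp
    have "(\<integral>\<^sup>+x. ennreal ((cmod (interp c x))\<^sup>2) * indicator s x \<partial>lebesgue)
      = (\<integral>\<^sup>+x. ennreal ((cmod (\<Sum>w\<in>vert s. c w * vertex_coord s w x))\<^sup>2) * indicator s x \<partial>lborel)"
      unfolding nn_integral_completion
      by (intro nn_integral_cong) (auto simp: indicator_def interp_on_simplex[OF s])
    then show "(\<integral>\<^sup>+x. ennreal ((cmod (interp c x))\<^sup>2) * indicator s x \<partial>lebesgue) =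
      ennreal (vol s / ((real DIM('a) + 1) * (real DIM('a) + 2)) *
       ((\<Sum>w\<in>vert s. (cmod (c w))\<^sup>2) + (cmod (\<Sum>w\<in>vert s. c w))\<^sup>2))"
      using full_dim_simplex.integral_affine_square[OF full_dim_simplex_vert[OF s], of c]
      by (simp only: hull_vert[OF s])
  qed
qed

text \<open>The star is described by vertices instead of points, so that both this sum and the sum over the
  vertices of a simplex run over the incidences of vertices and simplices.\<close>

lemma star_vol_eq:
  assumes w: "w \<in> V"
  shows "star_vol S w = (\<integral>\<^sup>+s. ennreal (vol s) * of_bool (w \<in> vert s) \<partial>count_space S)"
proof -
  have "star_vol S w = (\<integral>\<^sup>+s. emeasure lebesgue s \<partial>count_space (star S w))"
    unfolding star_vol_def
    by (rule nn_integral_count_space_infsum[symmetric])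
       (use countable_subset[OF _ countable_simplices] in \<open>auto simp: star_def\<close>)
  also have "\<dots> = (\<integral>\<^sup>+s. ennreal (vol s) * of_bool (w \<in> vert s) \<partial>count_space (star S w))"
    by (intro nn_integral_cong) (auto simp: star_eq[OF w] emeasure_simplex)
  also have "\<dots> = (\<integral>\<^sup>+s. ennreal (vol s) * of_bool (w \<in> vert s) \<partial>count_space S)"
    by (rule nn_integral_count_space_eq) (auto simp: star_eq[OF w])
  finally show ?thesis .
qed

definition star_weighted :: "('a \<Rightarrow> complex) \<Rightarrow> ennreal" where
  "star_weighted c = (\<integral>\<^sup>+w. ennreal ((cmod (c w))\<^sup>2) * star_vol S w \<partial>count_space V)"

text \<open>Double counting: the incidences \<open>w \<in> vert s\<close> are summed by vertex or by simplex.\<close>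

lemma star_weighted_eq:
  "star_weighted c = (\<integral>\<^sup>+s. ennreal (vol s * (\<Sum>w\<in>vert s. (cmod (c w))\<^sup>2)) \<partial>count_space S)"
proof -
  have "star_weighted c = (\<integral>\<^sup>+w. \<integral>\<^sup>+s. ennreal ((cmod (c w))\<^sup>2) * (ennreal (vol s) * of_bool (w \<in> vert s)) \<partial>count_space S \<partial>count_space V)"
    unfolding star_weighted_def by (intro nn_integral_cong) (simp add: star_vol_eq nn_integral_cmult)
  also have "\<dots> = (\<integral>\<^sup>+s. \<integral>\<^sup>+w. ennreal ((cmod (c w))\<^sup>2) * (ennreal (vol s) * of_bool (w \<in> vert s)) \<partial>count_space V \<partial>count_space S)"
    using countable_simplices by (intro nn_integral_count_space_nn_integral) auto
  also have "\<dots> = (\<integral>\<^sup>+s. ennreal (vol s * (\<Sum>w\<in>vert s. (cmod (c w))\<^sup>2)) \<partial>count_space S)"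
  proof (intro nn_integral_cong)
    fix s assume "s \<in> space (count_space S)"
    then have s: "s \<in> S" by simp
    have "(\<integral>\<^sup>+w. ennreal ((cmod (c w))\<^sup>2) * (ennreal (vol s) * of_bool (w \<in> vert s)) \<partial>count_space V)
      = (\<Sum>w\<in>vert s. ennreal ((cmod (c w))\<^sup>2) * (ennreal (vol s) * of_bool (w \<in> vert s)))"
      by (rule nn_integral_count_space') (use s finite_vert vert_subset in auto)
    also have "\<dots> = (\<Sum>w\<in>vert s. ennreal (vol s * (cmod (c w))\<^sup>2))"
      by (intro sum.cong) (auto simp: ennreal_mult mult.commute)
    also have "\<dots> = ennreal (vol s * (\<Sum>w\<in>vert s. (cmod (c w))\<^sup>2))"
      by (simp add: sum_distrib_left)
    finally show "(\<integral>\<^sup>+w. ennreal ((cmod (c w))\<^sup>2) * (ennreal (vol s) * of_bool (w \<in> vert s)) \<partial>count_space V)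
      = ennreal (vol s * (\<Sum>w\<in>vert s. (cmod (c w))\<^sup>2))" .
  qed
  finally show ?thesis .
qed

text \<open>The lower bound discards the nonnegative terms \<open>\<bar>\<Sum> c\<^sub>w\<bar>\<^sup>2\<close> of the simplices.\<close>

lemma energy_ge_star_weighted: "ennreal (1 / ((real DIM('a) + 1) * (real DIM('a) + 2))) * star_weighted c \<le> energy (interp c)"
  unfolding energy_interp star_weighted_eq
  by (subst nn_integral_cmult[symmetric])
     (auto intro!: nn_integral_mono ennreal_leI divide_right_mono mult_left_mono simp: ennreal_mult'[symmetric])

text \<open>By Cauchy-Schwarz \<open>\<bar>\<Sum> c\<^sub>w\<bar>\<^sup>2 \<le> (d+1) \<Sum> \<bar>c\<^sub>w\<bar>\<^sup>2\<close> on each simplex, and \<open>1 + (d+1) = d+2\<close>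
  cancels a factor of the denominator.\<close>

lemma energy_le_star_weighted: "energy (interp c) \<le> ennreal (1 / (real DIM('a) + 1)) * star_weighted c"
proof -
  have "vol s / ((real DIM('a) + 1) * (real DIM('a) + 2)) * ((\<Sum>w\<in>vert s. (cmod (c w))\<^sup>2) + (cmod (\<Sum>w\<in>vert s. c w))\<^sup>2)
     \<le> 1 / (real DIM('a) + 1) * (vol s * (\<Sum>w\<in>vert s. (cmod (c w))\<^sup>2))" if s: "s \<in> S" for s
  proof -
    have "(cmod (\<Sum>w\<in>vert s. c w))\<^sup>2 \<le> (\<Sum>w\<in>vert s. cmod (c w))\<^sup>2"
      by (intro power_mono norm_sum) auto
    also have "\<dots> \<le> (\<Sum>w\<in>vert s. (cmod (c w))\<^sup>2) * real (card (vert s))"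
      using sum_squared_le_sum_of_squares[of "\<lambda>w. cmod (c w)" "vert s"] finite_vert[OF s] by (simp add: mult.commute)
    also have "real (card (vert s)) = real DIM('a) + 1"
      using full_dim_simplex.card_vertices[OF full_dim_simplex_vert[OF s]] by simp
    finally have "(\<Sum>w\<in>vert s. (cmod (c w))\<^sup>2) + (cmod (\<Sum>w\<in>vert s. c w))\<^sup>2
        \<le> (real DIM('a) + 2) * (\<Sum>w\<in>vert s. (cmod (c w))\<^sup>2)"
      by (simp add: algebra_simps)
    then have "vol s / ((real DIM('a) + 1) * (real DIM('a) + 2)) * ((\<Sum>w\<in>vert s. (cmod (c w))\<^sup>2) + (cmod (\<Sum>w\<in>vert s. c w))\<^sup>2)
      \<le> vol s / ((real DIM('a) + 1) * (real DIM('a) + 2)) * ((real DIM('a) + 2) * (\<Sum>w\<in>vert s. (cmod (c w))\<^sup>2))"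
      by (intro mult_left_mono) auto
    also have "\<dots> = 1 / (real DIM('a) + 1) * (vol s * (\<Sum>w\<in>vert s. (cmod (c w))\<^sup>2))"
      by simp
    finally show ?thesis .
  qed
  then show ?thesis
    unfolding energy_interp star_weighted_eq
    by (subst nn_integral_cmult[symmetric])
       (auto intro!: nn_integral_mono ennreal_leI simp: ennreal_mult'[symmetric] simp del: times_divide_eq_left)
qed

lemma star_weighted_single: "w \<in> V \<Longrightarrow> star_weighted (\<lambda>u. of_bool (u = w)) = star_vol S w"
  unfolding star_weighted_def by (subst nn_integral_count_space'[of "{w}"]) auto

text \<open>For a single coefficient the two sums in the energy coincide on each simplex of the star, which
  gives the factor \<open>2\<close>.\<close>

lemma energy_hat:
  assumes w: "w \<in> V"
  shows "energy (\<lambda>x. complex_of_real (hat S w x)) = ennreal (2 / ((real DIM('a) + 1) * (real DIM('a) + 2))) * star_vol S w"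
proof -
  let ?c = "\<lambda>u. of_bool (u = w) :: complex"
  have "energy (\<lambda>x. complex_of_real (hat S w x)) = energy (interp ?c)"
    unfolding energy_def by (intro nn_integral_cong) (simp add: hat_eq_interp[OF _ w, symmetric] flip: norm_of_real)
  also have "\<dots> = (\<integral>\<^sup>+s. ennreal (2 / ((real DIM('a) + 1) * (real DIM('a) + 2))) * ennreal (vol s * (\<Sum>w\<in>vert s. (cmod (?c w))\<^sup>2)) \<partial>count_space S)"
    unfolding energy_interp
  proof (intro nn_integral_cong)
    fix s assume "s \<in> space (count_space S)"
    then have f: "finite (vert s)" using finite_vert by simp
    have c: "(\<Sum>u\<in>vert s. ?c u) = of_bool (w \<in> vert s)" "(\<Sum>u\<in>vert s. (cmod (?c u))\<^sup>2) = of_bool (w \<in> vert s)"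
      using f by (auto simp: of_bool_def if_distrib[of "\<lambda>x. (cmod x)\<^sup>2"] cong: if_cong)
    show "ennreal (vol s / ((real DIM('a) + 1) * (real DIM('a) + 2)) * ((\<Sum>w\<in>vert s. (cmod (?c w))\<^sup>2) + (cmod (\<Sum>w\<in>vert s. ?c w))\<^sup>2))
      = ennreal (2 / ((real DIM('a) + 1) * (real DIM('a) + 2))) * ennreal (vol s * (\<Sum>w\<in>vert s. (cmod (?c w))\<^sup>2))"
      unfolding c by (simp add: ennreal_mult'[symmetric])
  qed
  also have "\<dots> = ennreal (2 / ((real DIM('a) + 1) * (real DIM('a) + 2))) * star_weighted ?c"
    unfolding star_weighted_eq by (rule nn_integral_cmult) auto
  finally show ?thesis by (simp only: star_weighted_single[OF w])
qed

end

lemma (in triangulation) interp_cong: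
  assumes "x \<in> convex hull V" "\<And>w. w \<in> V \<Longrightarrow> c w = d w"
  shows "interp c x = interp d x"
  unfolding interp_def using assms by (intro sum.cong) auto

lemma (in triangulation) energy_cong:
  assumes "\<And>x. x \<in> convex hull V \<Longrightarrow> cmod (f x) = cmod (g x)"
  shows "energy f = energy g"
  unfolding energy_def using assms by (intro nn_integral_cong) simp


section \<open>Square roots and norms in the extended half-line\<close>

text \<open>The extended square root, an order isomorphism of \<open>[0, \<infinity>]\<close> with inverse \<open>y \<mapsto> y\<^sup>2\<close>. It thereby
  commutes with infima and suprema, empty ones included.\<close>

definition esqrt :: "ennreal \<Rightarrow> ennreal" where
  "esqrt z = (if z = \<infinity> then \<infinity> else ennreal (sqrt (enn2real z)))"

lemma L2_norm_eq_esqrt: "L2_norm N f = esqrt (\<integral>\<^sup>+x. ennreal ((norm (f x))\<^sup>2) \<partial>N)"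
  by (simp add: L2_norm_def esqrt_def Let_def)

lemma esqrt_power2: "(esqrt z)\<^sup>2 = z"
  by (cases z rule: ennreal_cases) (auto simp: esqrt_def ennreal_power power_eq_top_ennreal)

lemma esqrt_of_power2: "esqrt (y\<^sup>2) = y"
  by (cases y rule: ennreal_cases) (auto simp: esqrt_def ennreal_power power_eq_top_ennreal)

lemma esqrt_mono: "x \<le> y \<Longrightarrow> esqrt x \<le> esqrt y"
  by (cases x rule: ennreal_cases; cases y rule: ennreal_cases) (auto simp: esqrt_def top_unique intro!: ennreal_leI)

lemma esqrt_le_iff: "esqrt z \<le> y \<longleftrightarrow> z \<le> y\<^sup>2"
  by (metis esqrt_mono esqrt_of_power2 esqrt_power2 power_mono zero_le)

lemma le_esqrt_iff: "y \<le> esqrt z \<longleftrightarrow> y\<^sup>2 \<le> z"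
  by (metis esqrt_mono esqrt_of_power2 esqrt_power2 power_mono zero_le)

lemma esqrt_ennreal: "0 \<le> r \<Longrightarrow> esqrt (ennreal r) = ennreal (sqrt r)"
  by (simp add: esqrt_def)

lemma esqrt_pos_iff: "0 < esqrt z \<longleftrightarrow> 0 < z"
  using esqrt_le_iff[of z 0] by (simp add: zero_less_iff_neq_zero)

lemma esqrt_finite_iff: "esqrt z < \<infinity> \<longleftrightarrow> z < \<infinity>"
  by (simp add: esqrt_def less_top)

text \<open>Multiplication by a positive real is an order isomorphism of \<open>[0, \<infinity>]\<close>.\<close>

lemma ennreal_mult_galois:
  assumes "0 < a"
  shows "ennreal a * z \<le> u \<longleftrightarrow> z \<le> ennreal (1 / a) * u"
    and "u \<le> ennreal a * z \<longleftrightarrow> ennreal (1 / a) * u \<le> z"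
proof -
  have inv: "ennreal (1 / a) * (ennreal a * x) = x" "ennreal a * (ennreal (1 / a) * x) = x" for x
    using assms by (simp_all add: mult.assoc[symmetric] ennreal_mult'[symmetric])
  show "ennreal a * z \<le> u \<longleftrightarrow> z \<le> ennreal (1 / a) * u"
    "u \<le> ennreal a * z \<longleftrightarrow> ennreal (1 / a) * u \<le> z"
    by (metis inv mult_left_mono zero_le)+
qed

lemma esqrt_mult_SUP:
  assumes a: "0 < a"
  shows "(SUP w\<in>V. esqrt (ennreal a * f w)) = esqrt (ennreal a * (SUP w\<in>V. f w))"
proof (rule antisym)
  show "(SUP w\<in>V. esqrt (ennreal a * f w)) \<le> esqrt (ennreal a * (SUP w\<in>V. f w))"
    by (intro SUP_least esqrt_mono mult_left_mono SUP_upper) auto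
  show "esqrt (ennreal a * (SUP w\<in>V. f w)) \<le> (SUP w\<in>V. esqrt (ennreal a * f w))"
    unfolding esqrt_le_iff ennreal_mult_galois[OF a]
  proof (rule SUP_least)
    fix w assume "w \<in> V"
    then have "esqrt (ennreal a * f w) \<le> (SUP w\<in>V. esqrt (ennreal a * f w))" by (rule SUP_upper)
    then show "f w \<le> ennreal (1 / a) * (SUP w\<in>V. esqrt (ennreal a * f w))\<^sup>2"
      unfolding esqrt_le_iff ennreal_mult_galois[OF a] .
  qed
qed

lemma esqrt_mult_INF:
  assumes a: "0 < a"
  shows "(INF w\<in>V. esqrt (ennreal a * f w)) = esqrt (ennreal a * (INF w\<in>V. f w))"
proof (rule antisym)
  show "esqrt (ennreal a * (INF w\<in>V. f w)) \<le> (INF w\<in>V. esqrt (ennreal a * f w))"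
    by (intro INF_greatest esqrt_mono mult_left_mono INF_lower) auto
  show "(INF w\<in>V. esqrt (ennreal a * f w)) \<le> esqrt (ennreal a * (INF w\<in>V. f w))"
    unfolding le_esqrt_iff ennreal_mult_galois[OF a]
  proof (rule INF_greatest)
    fix w assume "w \<in> V"
    then have "(INF w\<in>V. esqrt (ennreal a * f w)) \<le> esqrt (ennreal a * f w)" by (rule INF_lower)
    then show "ennreal (1 / a) * (INF w\<in>V. esqrt (ennreal a * f w))\<^sup>2 \<le> f w"
      unfolding le_esqrt_iff ennreal_mult_galois[OF a] .
  qed
qed

lemma L2_norm_cong_AE:
  "(AE x in N. norm (f x) = norm (g x)) \<Longrightarrow> L2_norm N f = L2_norm N g"
  unfolding L2_norm_eq_esqrt by (intro arg_cong[where f = esqrt] nn_integral_cong_AE) (auto elim!: eventually_mono)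

lemma L2_norm_cong:
  "(\<And>x. x \<in> space N \<Longrightarrow> norm (f x) = norm (g x)) \<Longrightarrow> L2_norm N f = L2_norm N g"
  by (intro L2_norm_cong_AE AE_I2)

lemma L2_norm_eq_0_AE:
  fixes f g :: "'a \<Rightarrow> complex"
  assumes [measurable]: "f \<in> borel_measurable N" "g \<in> borel_measurable N" and "L2_norm N (\<lambda>x. f x - g x) = 0"
  shows "AE x in N. f x = g x"
proof -
  have "(\<integral>\<^sup>+x. ennreal ((norm (f x - g x))\<^sup>2) \<partial>N) = 0"
    using assms(3) esqrt_le_iff[of _ 0] unfolding L2_norm_eq_esqrt by fastforce
  then show ?thesis by (simp add: nn_integral_0_iff_AE)
qed


section \<open>Riesz bounds of a family and the norms of its members\<close>

text \<open>Apply the Riesz inequality to the unit sequence at \<open>k\<close>. Its partial sums are eventually equal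
  to \<open>\<phi> k\<close>, so the \<open>L2\<close> sum agrees with \<open>\<phi> k\<close> almost everywhere.\<close>

lemma riesz_inequality_bounds_members:
  assumes k: "k \<in> I" and meas: "\<phi> k \<in> borel_measurable N" and R: "riesz_inequality N I \<phi> A B"
  shows "ennreal A \<le> L2_norm N (\<phi> k)" "L2_norm N (\<phi> k) \<le> ennreal B"
proof -
  let ?c = "\<lambda>j. of_bool (j = k) :: complex"
  have c: "((\<lambda>j. (cmod (?c j))\<^sup>2) has_sum 1) I"
  proof -
    have "((\<lambda>j. (cmod (?c j))\<^sup>2) has_sum 1) {k}"
      using has_sum_finite[of "{k}" "\<lambda>j. (cmod (?c j))\<^sup>2"] by simp
    then show ?thesis
      by (rule has_sum_cong_neutral[THEN iffD1, rotated -1]) (use k in auto)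
  qed
  then have "?c \<in> ell2 I" "ell2_norm I ?c = 1"
    by (auto simp: ell2_def ell2_norm_def summable_on_def infsumI)
  then obtain f where f: "L2_has_sum N I (\<lambda>k x. ?c k * \<phi> k x) f"
    "ennreal A \<le> L2_norm N f" "L2_norm N f \<le> ennreal B"
    using R unfolding riesz_inequality_def by (metis mult.right_neutral)
  have "\<forall>\<^sub>F F in finite_subsets_at_top I. L2_norm N (\<lambda>x. (\<Sum>k\<in>F. ?c k * \<phi> k x) - f x) = L2_norm N (\<lambda>x. \<phi> k x - f x)"
  proof (rule eventually_mono)
    show "\<forall>\<^sub>F F in finite_subsets_at_top I. finite F \<and> k \<in> F"
      using k by (auto simp: eventually_finite_subsets_at_top intro!: exI[of _ "{k}"])
    fix F assume "finite F \<and> k \<in> F"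
    then have "(\<Sum>j\<in>F. ?c j * \<phi> j x) = \<phi> k x" for x
      by (subst sum.remove[of _ k]) (auto intro!: sum.neutral)
    then show "L2_norm N (\<lambda>x. (\<Sum>k\<in>F. ?c k * \<phi> k x) - f x) = L2_norm N (\<lambda>x. \<phi> k x - f x)" by simp
  qed
  moreover have "((\<lambda>F. L2_norm N (\<lambda>x. (\<Sum>k\<in>F. ?c k * \<phi> k x) - f x)) \<longlongrightarrow> 0) (finite_subsets_at_top I)"
    using f(1) unfolding L2_has_sum_def by blast
  ultimately have "((\<lambda>_. L2_norm N (\<lambda>x. \<phi> k x - f x)) \<longlongrightarrow> 0) (finite_subsets_at_top I)"
    by (rule tendsto_cong[THEN iffD1])
  then have "L2_norm N (\<lambda>x. \<phi> k x - f x) = 0"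
    by (simp add: tendsto_const_iff)
  moreover have "f \<in> borel_measurable N"
    using f(1) unfolding L2_has_sum_def L2_def by blast
  ultimately have "AE x in N. \<phi> k x = f x"
    using L2_norm_eq_0_AE meas by blast
  then have "L2_norm N (\<phi> k) = L2_norm N f"
    by (intro L2_norm_cong_AE) (auto elim!: eventually_mono)
  with f show "ennreal A \<le> L2_norm N (\<phi> k)" "L2_norm N (\<phi> k) \<le> ennreal B" by auto
qed

text \<open>Testing on the member \<open>\<phi> k\<close> shows that every lower Riesz bound is at most every upper one.
  The set of lower bounds is therefore bounded above, and its supremum is not a default value.\<close>

lemma riesz_condition_number_le:
  assumes k: "k \<in> I" and meas: "\<phi> k \<in> borel_measurable N" and R: "riesz_inequality N I \<phi> A B" and A: "0 < A"
  shows "riesz_condition_number N I \<phi> \<le> B / A"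
proof -
  note bounds = riesz_inequality_bounds_members[where N = N and \<phi> = \<phi>, OF k meas]
  have le: "A' \<le> B'" if "riesz_inequality N I \<phi> A' C" "riesz_inequality N I \<phi> D B'" "0 < A'" for A' B' C D
    using order_trans[OF bounds(1)[OF that(1)] bounds(2)[OF that(2)]] that(3)
    by (simp add: ennreal_le_iff2)
  have AB: "A \<le> B" using le[OF R R A] .
  have "A \<le> riesz_lower_bound N I \<phi>"
    unfolding riesz_lower_bound_def
  proof (rule cSup_upper)
    show "A \<in> {A. 0 < A \<and> (\<exists>B\<ge>A. riesz_inequality N I \<phi> A B)}" using A AB R by blast
    show "bdd_above {A. 0 < A \<and> (\<exists>B\<ge>A. riesz_inequality N I \<phi> A B)}"
      using le[OF _ R] by (intro bdd_aboveI[of _ B]) blast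
  qed
  moreover have "riesz_upper_bound N I \<phi> \<le> B"
    unfolding riesz_upper_bound_def
    by (rule cInf_lower) (use A AB R in \<open>auto intro!: bdd_belowI[of _ 0]\<close>)
  moreover have "0 \<le> riesz_upper_bound N I \<phi>"
    unfolding riesz_upper_bound_def by (rule cInf_greatest) (use A AB R in auto)
  ultimately show ?thesis
    unfolding riesz_condition_number_def using A by (intro frac_le) auto
qed


section \<open>Riesz bounds of the hat functions\<close>

locale indexed_triangulation = triangulation V S
  for V :: "'a::euclidean_space set" and S +
  fixes v :: "nat \<Rightarrow> 'a" and I :: "nat set"
  assumes indexing: "bij_betw v I V"
    and nonempty: "V \<noteq> {}"
begin

abbreviation \<beta> :: "nat \<Rightarrow> 'a \<Rightarrow> complex" where
  "\<beta> k x \<equiv> complex_of_real (hat S (v k) x)"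

definition Vinf :: ennreal where "Vinf = (INF w\<in>V. star_vol S w)"
definition Vsup :: ennreal where "Vsup = (SUP w\<in>V. star_vol S w)"

text \<open>The coefficients \<open>c\<close>, restricted to the indices in \<open>K\<close> and transported to the vertices; zero
  elsewhere. With \<open>K = F\<close> finite this gives partial sums, with \<open>K = I - F\<close> the remainders.\<close>

definition coeff :: "nat set \<Rightarrow> (nat \<Rightarrow> complex) \<Rightarrow> 'a \<Rightarrow> complex" where
  "coeff K c w = (if w \<in> v ` K then c (inv_into I v w) else 0)"

definition coeff_sq_sum :: "('a \<Rightarrow> complex) \<Rightarrow> ennreal" where
  "coeff_sq_sum c = (\<integral>\<^sup>+w. ennreal ((cmod (c w))\<^sup>2) \<partial>count_space V)"

lemma v_mem: "k \<in> I \<Longrightarrow> v k \<in> V"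
  using indexing bij_betwE by blast

lemma inv_v: "k \<in> I \<Longrightarrow> inv_into I v (v k) = k"
  using indexing by (simp add: bij_betw_def)

lemma v_mem_image_iff: "k \<in> I \<Longrightarrow> K \<subseteq> I \<Longrightarrow> v k \<in> v ` K \<longleftrightarrow> k \<in> K"
  using indexing unfolding bij_betw_def by (auto dest: inj_onD)

lemma coeff_v: "k \<in> I \<Longrightarrow> K \<subseteq> I \<Longrightarrow> coeff K c (v k) = (if k \<in> K then c k else 0)"
  by (simp add: coeff_def v_mem_image_iff inv_v)

lemma coeff_sq_sum_eq: "coeff_sq_sum c = (\<integral>\<^sup>+k. ennreal ((cmod (c (v k)))\<^sup>2) \<partial>count_space I)"
  unfolding coeff_sq_sum_def by (rule nn_integral_bij_count_space[OF indexing, symmetric])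

lemma coeff_sq_sum_coeff:
  assumes c: "c \<in> ell2 I" and K: "K \<subseteq> I"
  shows "coeff_sq_sum (coeff K c) = ennreal (\<Sum>\<^sub>\<infinity>k\<in>K. (cmod (c k))\<^sup>2)"
proof -
  have "coeff_sq_sum (coeff K c) = (\<integral>\<^sup>+k. ennreal ((cmod (coeff K c (v k)))\<^sup>2) \<partial>count_space K)"
    unfolding coeff_sq_sum_eq using K by (intro nn_integral_count_space_eq) (auto simp: coeff_v)
  also have "\<dots> = (\<integral>\<^sup>+k. ennreal ((cmod (c k))\<^sup>2) \<partial>count_space K)"
    using K by (intro nn_integral_cong) (auto simp: coeff_v subset_iff)
  also have "\<dots> = ennreal (\<Sum>\<^sub>\<infinity>k\<in>K. (cmod (c k))\<^sup>2)"
    using c summable_on_subset_banach[OF _ K] by (intro nn_integral_count_space_real) (auto simp: ell2_def)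
  finally show ?thesis .
qed

lemma partial_sum_interp:
  assumes F: "finite F" "F \<subseteq> I" and x: "x \<in> convex hull V"
  shows "(\<Sum>k\<in>F. c k * \<beta> k x) = interp (coeff F c) x"
proof -
  have inj: "inj_on v F" using indexing F(2) inj_on_subset unfolding bij_betw_def by blast
  have "(\<Sum>k\<in>F. c k * \<beta> k x) = (\<Sum>w\<in>v ` F. c (inv_into I v w) * complex_of_real (hat S w x))"
    using F(2) by (simp add: sum.reindex[OF inj] inv_v subset_iff)
  also have "\<dots> = interp (coeff F c) x"
    unfolding coeff_def by (rule sum_hat_eq_interp[OF x]) (use F v_mem in auto)
  finally show ?thesis .
qed

lemma beta_measurable: "k \<in> I \<Longrightarrow> \<beta> k \<in> borel_measurable M"
  by (rule measurable_cong[THEN iffD1, OF _ interp_measurable])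
     (simp add: hat_eq_interp[OF _ v_mem] space_restrict_space)

lemma L2_norm_energy: "L2_norm M f = esqrt (energy f)"
  by (simp add: L2_norm_eq_esqrt energy_def)

lemma L2_norm_hat:
  assumes "w \<in> V"
  shows "L2_norm M (hat S w) = esqrt (ennreal (2 / ((real DIM('a) + 1) * (real DIM('a) + 2))) * star_vol S w)"
proof -
  have "L2_norm M (hat S w) = L2_norm M (\<lambda>x. complex_of_real (hat S w x))"
    by (intro L2_norm_cong) simp
  then show ?thesis by (simp only: L2_norm_energy energy_hat[OF assms])
qed

lemma energy_lower:
  "ennreal (1 / ((real DIM('a) + 1) * (real DIM('a) + 2))) * (Vinf * coeff_sq_sum c) \<le> energy (interp c)"
proof -
  have "Vinf * coeff_sq_sum c \<le> star_weighted c"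
    unfolding coeff_sq_sum_def star_weighted_def
    by (subst nn_integral_cmult[symmetric])
       (auto intro!: nn_integral_mono mult_right_mono INF_lower simp: Vinf_def mult.commute)
  from mult_left_mono[OF this] energy_ge_star_weighted[of c] show ?thesis by (meson order_trans zero_le)
qed

lemma energy_upper:
  "energy (interp c) \<le> ennreal (1 / (real DIM('a) + 1)) * (Vsup * coeff_sq_sum c)"
proof -
  have "star_weighted c \<le> Vsup * coeff_sq_sum c"
    unfolding coeff_sq_sum_def star_weighted_def
    by (subst nn_integral_cmult[symmetric])
       (auto intro!: nn_integral_mono mult_right_mono SUP_upper simp: Vsup_def mult.commute)
  from mult_left_mono[OF this] energy_le_star_weighted[of c] show ?thesis by (meson order_trans zero_le)
qed

lemma Ninf_eq: "(INF w\<in>V. L2_norm M (hat S w)) = esqrt (ennreal (2 / ((real DIM('a) + 1) * (real DIM('a) + 2))) * Vinf)"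
  unfolding Vinf_def by (subst esqrt_mult_INF[symmetric]) (auto simp: L2_norm_hat intro!: INF_cong)

lemma Nsup_eq: "(SUP w\<in>V. L2_norm M (hat S w)) = esqrt (ennreal (2 / ((real DIM('a) + 1) * (real DIM('a) + 2))) * Vsup)"
  unfolding Vsup_def by (subst esqrt_mult_SUP[symmetric]) (auto simp: L2_norm_hat intro!: SUP_cong)

text \<open>Up to the order isomorphism \<open>esqrt\<close> and a positive factor, the norms of the hat functions are the
  volumes of the stars, so conditions (ii) and (iii) coincide.\<close>

lemma star_bounds_iff_norm_bounds:
  "Vinf > 0 \<and> Vsup < \<infinity> \<longleftrightarrow>
   (INF w\<in>V. L2_norm M (hat S w)) > 0 \<and> (SUP w\<in>V. L2_norm M (hat S w)) < \<infinity>"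
  unfolding Ninf_eq Nsup_eq esqrt_pos_iff esqrt_finite_iff
  by (auto simp: ennreal_zero_less_mult_iff ennreal_mult_less_top)

lemma riesz_inequality_imp_star_bounds:
  assumes R: "riesz_inequality M I \<beta> A B" and A: "0 < A"
  shows "Vinf > 0 \<and> Vsup < \<infinity>"
  unfolding star_bounds_iff_norm_bounds
proof
  have b: "ennreal A \<le> L2_norm M (hat S w)" "L2_norm M (hat S w) \<le> ennreal B" if w: "w \<in> V" for w
  proof -
    obtain k where k: "k \<in> I" "w = v k" using indexing w unfolding bij_betw_def by blast
    have "L2_norm M (\<beta> k) = L2_norm M (hat S w)"
      unfolding k(2) by (intro L2_norm_cong) simp
    then show "ennreal A \<le> L2_norm M (hat S w)" "L2_norm M (hat S w) \<le> ennreal B"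
      using riesz_inequality_bounds_members[OF k(1) beta_measurable[OF k(1)] R] by simp_all
  qed
  have "0 < ennreal A" using A by simp
  also have "ennreal A \<le> (INF w\<in>V. L2_norm M (hat S w))" using b by (intro INF_greatest)
  finally show "(INF w\<in>V. L2_norm M (hat S w)) > 0" .
  have "(SUP w\<in>V. L2_norm M (hat S w)) \<le> ennreal B" using b by (intro SUP_least)
  then show "(SUP w\<in>V. L2_norm M (hat S w)) < \<infinity>" by (simp add: le_less_trans)
qed

lemma L2_norm_le_ennreal: "0 \<le> b \<Longrightarrow> L2_norm M f \<le> ennreal b \<longleftrightarrow> energy f \<le> ennreal (b\<^sup>2)"
  unfolding L2_norm_energy esqrt_le_iff by (simp add: ennreal_power)

lemma L2_norm_ge_ennreal: "0 \<le> b \<Longrightarrow> ennreal b \<le> L2_norm M f \<longleftrightarrow> ennreal (b\<^sup>2) \<le> energy f"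
  unfolding L2_norm_energy le_esqrt_iff by (simp add: ennreal_power)

end

locale bounded_stars = indexed_triangulation +
  assumes Vinf_pos: "Vinf > 0" and Vsup_finite: "Vsup < \<infinity>"
begin

lemma Vinf_le_Vsup: "Vinf \<le> Vsup"
  unfolding Vinf_def Vsup_def using nonempty by (intro INF_le_SUP) auto

lemma Vinf_eq: "Vinf = ennreal (enn2real Vinf)"
  using Vinf_le_Vsup Vsup_finite by (simp add: less_top top_unique)

lemma Vsup_eq: "Vsup = ennreal (enn2real Vsup)"
  using Vsup_finite by simp

lemma vinf_pos: "0 < enn2real Vinf"
  using Vinf_pos Vinf_eq by (metis ennreal_0 enn2real_nonneg less_irrefl less_eq_real_def)

lemma vinf_le_vsup: "enn2real Vinf \<le> enn2real Vsup"
  using Vinf_le_Vsup Vsup_finite by (intro enn2real_mono) auto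

lemma energy_upper_real:
  assumes "c \<in> ell2 I" "K \<subseteq> I"
  shows "energy (interp (coeff K c)) \<le>
    ennreal (enn2real Vsup / (real DIM('a) + 1) * (\<Sum>\<^sub>\<infinity>k\<in>K. (cmod (c k))\<^sup>2))"
proof -
  have "0 \<le> (\<Sum>\<^sub>\<infinity>k\<in>K. (cmod (c k))\<^sup>2)" by (rule infsum_nonneg) simp
  then have "ennreal (1 / (real DIM('a) + 1)) * (Vsup * coeff_sq_sum (coeff K c))
     = ennreal (enn2real Vsup / (real DIM('a) + 1) * (\<Sum>\<^sub>\<infinity>k\<in>K. (cmod (c k))\<^sup>2))"
    unfolding coeff_sq_sum_coeff[OF assms] by (subst Vsup_eq) (simp add: ennreal_mult'[symmetric])
  then show ?thesis using energy_upper[of "coeff K c"] by simp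
qed

lemma energy_lower_real:
  assumes "c \<in> ell2 I" "K \<subseteq> I"
  shows "ennreal (enn2real Vinf / ((real DIM('a) + 1) * (real DIM('a) + 2)) * (\<Sum>\<^sub>\<infinity>k\<in>K. (cmod (c k))\<^sup>2))
    \<le> energy (interp (coeff K c))"
proof -
  have "0 \<le> (\<Sum>\<^sub>\<infinity>k\<in>K. (cmod (c k))\<^sup>2)" by (rule infsum_nonneg) simp
  then have "ennreal (1 / ((real DIM('a) + 1) * (real DIM('a) + 2))) * (Vinf * coeff_sq_sum (coeff K c))
     = ennreal (enn2real Vinf / ((real DIM('a) + 1) * (real DIM('a) + 2)) * (\<Sum>\<^sub>\<infinity>k\<in>K. (cmod (c k))\<^sup>2))"
    unfolding coeff_sq_sum_coeff[OF assms] by (subst Vinf_eq) (simp add: ennreal_mult'[symmetric])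
  then show ?thesis using energy_lower[of "coeff K c"] by simp
qed

text \<open>The remainder of the series is again an interpolant, so the upper bound applies to it.\<close>

lemma L2_norm_tail_le:
  assumes c: "c \<in> ell2 I" and F: "finite F" "F \<subseteq> I"
  shows "L2_norm M (\<lambda>x. (\<Sum>k\<in>F. c k * \<beta> k x) - interp (coeff I c) x) \<le>
    ennreal (sqrt (enn2real Vsup / (real DIM('a) + 1) *
      ((\<Sum>\<^sub>\<infinity>k\<in>I. (cmod (c k))\<^sup>2) - (\<Sum>k\<in>F. (cmod (c k))\<^sup>2))))"
proof -
  have summable: "(\<lambda>k. (cmod (c k))\<^sup>2) summable_on I" using c by (simp add: ell2_def)
  have tail: "(\<Sum>\<^sub>\<infinity>k\<in>I - F. (cmod (c k))\<^sup>2) = (\<Sum>\<^sub>\<infinity>k\<in>I. (cmod (c k))\<^sup>2) - (\<Sum>k\<in>F. (cmod (c k))\<^sup>2)"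
    using infsum_Diff[OF summable summable_on_finite[OF F(1)] F(2)] F(1) by simp
  have tail_nonneg: "0 \<le> (\<Sum>\<^sub>\<infinity>k\<in>I - F. (cmod (c k))\<^sup>2)" by (rule infsum_nonneg) simp
  have "energy (\<lambda>x. (\<Sum>k\<in>F. c k * \<beta> k x) - interp (coeff I c) x) = energy (interp (coeff (I - F) c))"
  proof (rule energy_cong)
    fix x assume x: "x \<in> convex hull V"
    have "interp (coeff (I - F) c) x = interp (\<lambda>w. coeff I c w - coeff F c w) x"
    proof (rule interp_cong[OF x])
      fix w assume "w \<in> V"
      then obtain k where "k \<in> I" "w = v k" using indexing unfolding bij_betw_def by blast
      then show "coeff (I - F) c w = coeff I c w - coeff F c w"
        using F(2) by (simp add: coeff_v)
    qed
    also have "\<dots> = interp (coeff I c) x - (\<Sum>k\<in>F. c k * \<beta> k x)"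
      by (simp only: interp_diff[OF x] partial_sum_interp[OF F x])
    finally show "cmod ((\<Sum>k\<in>F. c k * \<beta> k x) - interp (coeff I c) x) = cmod (interp (coeff (I - F) c) x)"
      by (simp only: norm_minus_commute)
  qed
  also have "\<dots> \<le> ennreal (enn2real Vsup / (real DIM('a) + 1) * (\<Sum>\<^sub>\<infinity>k\<in>I - F. (cmod (c k))\<^sup>2))"
    by (rule energy_upper_real[OF c]) auto
  finally have "L2_norm M (\<lambda>x. (\<Sum>k\<in>F. c k * \<beta> k x) - interp (coeff I c) x) \<le>
    ennreal (sqrt (enn2real Vsup / (real DIM('a) + 1) * (\<Sum>\<^sub>\<infinity>k\<in>I - F. (cmod (c k))\<^sup>2)))"
    using tail_nonneg by (subst L2_norm_le_ennreal) auto
  then show ?thesis unfolding tail .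
qed

lemma series_has_sum:
  assumes c: "c \<in> ell2 I"
  shows "L2_has_sum M I (\<lambda>k x. c k * \<beta> k x) (interp (coeff I c))"
  unfolding L2_has_sum_def
proof
  have "energy (interp (coeff I c)) < \<infinity>"
    using energy_upper_real[OF c order_refl] by (simp add: le_less_trans)
  then show "interp (coeff I c) \<in> L2 M"
    unfolding L2_def by (simp add: interp_measurable L2_norm_energy esqrt_finite_iff[unfolded infinity_ennreal_def])
  let ?q = "\<lambda>k. (cmod (c k))\<^sup>2"
  have "(?q has_sum infsum ?q I) I"
    using c by (intro has_sum_infsum) (simp add: ell2_def)
  then have "((\<lambda>F. ennreal (sqrt (enn2real Vsup / (real DIM('a) + 1) * (infsum ?q I - sum ?q F)))) \<longlongrightarrow>
      ennreal (sqrt (enn2real Vsup / (real DIM('a) + 1) * (infsum ?q I - infsum ?q I)))) (finite_subsets_at_top I)"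
    unfolding has_sum_def by (intro tendsto_intros)
  then have upper: "((\<lambda>F. ennreal (sqrt (enn2real Vsup / (real DIM('a) + 1) * (infsum ?q I - sum ?q F)))) \<longlongrightarrow> 0) (finite_subsets_at_top I)"
    by simp
  show "((\<lambda>F. L2_norm M (\<lambda>x. (\<Sum>k\<in>F. c k * \<beta> k x) - interp (coeff I c) x)) \<longlongrightarrow> 0) (finite_subsets_at_top I)"
  proof (rule tendsto_sandwich[OF _ _ tendsto_const upper])
    show "\<forall>\<^sub>F F in finite_subsets_at_top I. L2_norm M (\<lambda>x. (\<Sum>k\<in>F. c k * \<beta> k x) - interp (coeff I c) x)
       \<le> ennreal (sqrt (enn2real Vsup / (real DIM('a) + 1) * (infsum ?q I - sum ?q F)))"
      using L2_norm_tail_le[OF c] by (intro eventually_finite_subsets_at_top_weakI) auto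
  qed simp
qed

lemma riesz_inequality_star:
  "riesz_inequality M I \<beta> (sqrt (enn2real Vinf / ((real DIM('a) + 1) * (real DIM('a) + 2))))
     (sqrt (enn2real Vsup / (real DIM('a) + 1)))"
  unfolding riesz_inequality_def
proof (intro ballI exI conjI)
  fix c assume c: "c \<in> ell2 I"
  have nonneg: "0 \<le> (\<Sum>\<^sub>\<infinity>k\<in>I. (cmod (c k))\<^sup>2)" by (rule infsum_nonneg) simp
  show "L2_has_sum M I (\<lambda>k x. c k * \<beta> k x) (interp (coeff I c))"
    by (rule series_has_sum[OF c])
  show "ennreal (sqrt (enn2real Vinf / ((real DIM('a) + 1) * (real DIM('a) + 2))) * ell2_norm I c)
      \<le> L2_norm M (interp (coeff I c))"
    using energy_lower_real[OF c order_refl] nonneg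
    by (subst L2_norm_ge_ennreal) (auto simp: ell2_norm_def power_mult_distrib)
  show "L2_norm M (interp (coeff I c)) \<le> ennreal (sqrt (enn2real Vsup / (real DIM('a) + 1)) * ell2_norm I c)"
    using energy_upper_real[OF c order_refl] nonneg
    by (subst L2_norm_le_ennreal) (auto simp: ell2_norm_def power_mult_distrib)
qed

end


section \<open>The closed span of the hat functions\<close>

context bounded_stars begin

text \<open>A continuous piecewise-linear function is the interpolant of its vertex values, and the lower
  bound controls these by its \<open>L2\<close> norm.\<close>

lemma cpwl_coefficients_ell2:
  assumes h: "h \<in> cpwl V S" "h \<in> L2 M"
  shows "(\<lambda>k. h (v k)) \<in> ell2 I"
proof -
  have "energy (interp h) = energy h"
    using cpwl_eq_interp[OF h(1)] by (intro energy_cong) simp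
  then have "ennreal (1 / ((real DIM('a) + 1) * (real DIM('a) + 2))) * (Vinf * coeff_sq_sum h) \<le> energy h"
    using energy_lower[of h] by simp
  also have "energy h < \<infinity>"
    using h(2) unfolding L2_def by (simp add: L2_norm_energy esqrt_finite_iff[unfolded infinity_ennreal_def])
  finally have "coeff_sq_sum h < \<infinity>"
    using Vinf_pos by (auto simp: ennreal_mult_less_top ennreal_mult_eq_top_iff less_top[symmetric] zero_less_iff_neq_zero)
  then show ?thesis
    unfolding ell2_def coeff_sq_sum_eq by (auto intro!: summable_on_if_nn_integral_finite)
qed

text \<open>The partial sums of the hat series with the vertex values as coefficients converge to the
  function in \<open>L2\<close>.\<close>

lemma cpwl_class_in_closure:
  assumes f: "f \<in> L2_classes M (cpwl V S \<inter> L2 M)"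
  shows "f \<in> L2_closure M (fun_span I \<beta>)"
proof -
  obtain h where fL2: "f \<in> L2 M" and h: "h \<in> cpwl V S" "h \<in> L2 M" and ae: "AE x in M. f x = h x"
    using f unfolding L2_classes_def by blast
  define c where "c k = h (v k)" for k
  have c: "c \<in> ell2 I" unfolding c_def by (rule cpwl_coefficients_ell2[OF h])
  have ae': "AE x in M. f x = interp (coeff I c) x"
  proof -
    have eq: "h x = interp (coeff I c) x" if x: "x \<in> convex hull V" for x
    proof -
      have "interp h x = interp (coeff I c) x"
      proof (rule interp_cong[OF x])
        fix w assume "w \<in> V"
        then obtain k where "k \<in> I" "w = v k" using indexing unfolding bij_betw_def by blast
        then show "h w = coeff I c w" by (simp add: coeff_v c_def)
      qed
      then show ?thesis using cpwl_eq_interp[OF h(1) x] by simp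
    qed
    have "AE x in M. h x = interp (coeff I c) x"
      by (rule AE_I2) (simp add: eq space_restrict_space)
    with ae show ?thesis by (auto elim: eventually_elim2)
  qed
  have "\<exists>g\<in>fun_span I \<beta>. L2_norm M (\<lambda>x. f x - g x) < e" if e: "0 < e" for e :: ennreal
  proof -
    have "\<forall>\<^sub>F F in finite_subsets_at_top I. L2_norm M (\<lambda>x. (\<Sum>k\<in>F. c k * \<beta> k x) - interp (coeff I c) x) < e"
      using series_has_sum[OF c] e unfolding L2_has_sum_def by (auto dest: order_tendstoD(2))
    then obtain F where F: "finite F" "F \<subseteq> I"
      "L2_norm M (\<lambda>x. (\<Sum>k\<in>F. c k * \<beta> k x) - interp (coeff I c) x) < e"
      unfolding eventually_finite_subsets_at_top by blast
    have "L2_norm M (\<lambda>x. f x - (\<Sum>k\<in>F. c k * \<beta> k x)) = L2_norm M (\<lambda>x. (\<Sum>k\<in>F. c k * \<beta> k x) - interp (coeff I c) x)"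
      using ae' by (intro L2_norm_cong_AE) (auto elim!: eventually_mono simp: norm_minus_commute)
    with F show ?thesis unfolding fun_span_def by (intro bexI[of _ "\<lambda>x. \<Sum>k\<in>F. c k * \<beta> k x"]) auto
  qed
  then show ?thesis using fL2 unfolding L2_closure_def by blast
qed

text \<open>The lower Riesz bound with all coefficients but one discarded.\<close>

lemma coefficient_le_energy:
  assumes w: "w \<in> V" and e: "energy (interp c) \<le> ennreal e" and e0: "0 \<le> e"
  shows "(cmod (c w))\<^sup>2 \<le> (real DIM('a) + 1) * (real DIM('a) + 2) / enn2real Vinf * e"
proof -
  let ?k = "1 / ((real DIM('a) + 1) * (real DIM('a) + 2))"
  have "ennreal ((cmod (c w))\<^sup>2) \<le> coeff_sq_sum c"
    unfolding coeff_sq_sum_def using w by (rule nn_integral_ge_point)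
  then have "ennreal ?k * (Vinf * ennreal ((cmod (c w))\<^sup>2)) \<le> ennreal ?k * (Vinf * coeff_sq_sum c)"
    by (intro mult_left_mono) auto
  also have "\<dots> \<le> energy (interp c)" by (rule energy_lower)
  also have "\<dots> \<le> ennreal e" by (rule e)
  finally have "ennreal (?k * (enn2real Vinf * (cmod (c w))\<^sup>2)) \<le> ennreal e"
    by (subst (asm) Vinf_eq) (simp add: ennreal_mult'[symmetric])
  then have "?k * (enn2real Vinf * (cmod (c w))\<^sup>2) \<le> e"
    using e0 by (simp add: ennreal_le_iff)
  then have "enn2real Vinf * (cmod (c w))\<^sup>2 \<le> e * ((real DIM('a) + 1) * (real DIM('a) + 2))"
    by (subst (asm) mult.commute, subst (asm) times_divide_eq_right, subst (asm) pos_divide_le_eq) simp_all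
  then show ?thesis using vinf_pos by (simp add: pos_le_divide_eq mult_ac)
qed

text \<open>Two approximants are compared through the function that both approximate.\<close>

lemma energy_diff_le:
  assumes [measurable]: "f \<in> borel_measurable M" "g \<in> borel_measurable M" "h \<in> borel_measurable M"
  shows "energy (\<lambda>x. g x - h x) \<le> 2 * energy (\<lambda>x. f x - g x) + 2 * energy (\<lambda>x. f x - h x)"
proof -
  have "(cmod (g x - h x))\<^sup>2 \<le> 2 * (cmod (f x - g x))\<^sup>2 + 2 * (cmod (f x - h x))\<^sup>2" for x
  proof -
    have "cmod (g x - h x) \<le> cmod (f x - g x) + cmod (f x - h x)"
      using norm_triangle_ineq4[of "f x - h x" "f x - g x"] by simp
    then have "(cmod (g x - h x))\<^sup>2 \<le> (cmod (f x - g x) + cmod (f x - h x))\<^sup>2" by (intro power_mono) auto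
    also have "\<dots> \<le> 2 * (cmod (f x - g x))\<^sup>2 + 2 * (cmod (f x - h x))\<^sup>2"
      using sum_squares_bound[of "cmod (f x - g x)" "cmod (f x - h x)"] by (simp add: power2_sum)
    finally show ?thesis .
  qed
  then have "ennreal ((cmod (g x - h x))\<^sup>2) \<le> 2 * ennreal ((cmod (f x - g x))\<^sup>2) + 2 * ennreal ((cmod (f x - h x))\<^sup>2)" for x
    using ennreal_leI by (fastforce simp: ennreal_plus ennreal_mult)
  then have "energy (\<lambda>x. g x - h x) \<le> (\<integral>\<^sup>+x. 2 * ennreal ((cmod (f x - g x))\<^sup>2) + 2 * ennreal ((cmod (f x - h x))\<^sup>2) \<partial>M)"
    unfolding energy_def by (rule nn_integral_mono)
  also have "\<dots> = 2 * energy (\<lambda>x. f x - g x) + 2 * energy (\<lambda>x. f x - h x)"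
    unfolding energy_def by (simp add: nn_integral_add nn_integral_cmult)
  finally show ?thesis .
qed

lemma interp_limit:
  assumes x: "x \<in> convex hull V" and lim: "\<And>w. w \<in> V \<Longrightarrow> (\<lambda>n. C n w) \<longlonglongrightarrow> c w"
  shows "(\<lambda>n. interp (C n) x) \<longlonglongrightarrow> interp c x"
  unfolding interp_def by (intro tendsto_sum tendsto_mult_right lim) simp

lemma coeff_finite_continuous:
  assumes beta: "\<forall>k\<in>I. \<beta> k \<in> cpwl V S" and F: "finite F" "F \<subseteq> I"
  shows "continuous_on (convex hull V) (interp (coeff F c))"
proof -
  have "continuous_on (convex hull V) (\<lambda>x. \<Sum>k\<in>F. c k * \<beta> k x)"
  proof (intro continuous_on_sum continuous_on_mult_left)
    fix k assume "k \<in> F"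
    then show "continuous_on (convex hull V) (\<beta> k)" using beta F(2) unfolding cpwl_def by blast
  qed
  then show ?thesis
    by (rule continuous_on_cong[THEN iffD1, rotated -1]) (auto simp: partial_sum_interp[OF F])
qed

text \<open>The limit of the coefficients of the approximants is taken vertex by vertex; the interpolant of
  the limit is continuous as a uniform limit, and equals \<open>f\<close> almost everywhere by Fatou's lemma.\<close>

lemma closure_in_cpwl_class:
  assumes beta: "\<forall>k\<in>I. \<beta> k \<in> cpwl V S" and f: "f \<in> L2_closure M (fun_span I \<beta>)"
  shows "f \<in> L2_classes M (cpwl V S \<inter> L2 M)"
proof -
  have fL2: "f \<in> L2 M" using f unfolding L2_closure_def by blast
  then have f_meas: "f \<in> borel_measurable M" unfolding L2_def by blast
  define e :: "nat \<Rightarrow> real" where "e n = 1 / real (Suc n)" for n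
  have e_pos: "0 < e n" and e_lim: "e \<longlonglongrightarrow> 0" and e_antimono: "m \<ge> n \<Longrightarrow> e m \<le> e n" for m n
  proof -
    have "e = (\<lambda>n. inverse (real (Suc n)))" by (simp add: e_def fun_eq_iff inverse_eq_divide)
    then show "e \<longlonglongrightarrow> 0" using LIMSEQ_inverse_real_of_nat by simp
  qed (simp_all add: e_def frac_le)
  have "\<exists>F c. finite F \<and> F \<subseteq> I \<and> L2_norm M (\<lambda>x. f x - (\<Sum>k\<in>F. c k * \<beta> k x)) < ennreal (e n)" for n
  proof -
    obtain g where "g \<in> fun_span I \<beta>" "L2_norm M (\<lambda>x. f x - g x) < ennreal (e n)"
      using f e_pos[of n] unfolding L2_closure_def by (auto dest!: spec[of _ "ennreal (e n)"])
    then show ?thesis unfolding fun_span_def by blast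
  qed
  then have "\<forall>n. \<exists>F. \<exists>c. finite F \<and> F \<subseteq> I \<and> L2_norm M (\<lambda>x. f x - (\<Sum>k\<in>F. c k * \<beta> k x)) < ennreal (e n)"
    by blast
  from choice[OF this] obtain F where
    "\<forall>n. \<exists>c. finite (F n) \<and> F n \<subseteq> I \<and> L2_norm M (\<lambda>x. f x - (\<Sum>k\<in>F n. c k * \<beta> k x)) < ennreal (e n)" ..
  from choice[OF this] obtain c where
    c: "\<forall>n. finite (F n) \<and> F n \<subseteq> I \<and> L2_norm M (\<lambda>x. f x - (\<Sum>k\<in>F n. c n k * \<beta> k x)) < ennreal (e n)" ..
  then have F: "\<And>n. finite (F n)" "\<And>n. F n \<subseteq> I"
    and close: "\<And>n. L2_norm M (\<lambda>x. f x - (\<Sum>k\<in>F n. c n k * \<beta> k x)) < ennreal (e n)"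
    by blast+
  define C where "C n = coeff (F n) (c n)" for n
  have approx: "energy (\<lambda>x. f x - interp (C n) x) \<le> ennreal ((e n)\<^sup>2)" for n
  proof -
    have "L2_norm M (\<lambda>x. f x - interp (C n) x) = L2_norm M (\<lambda>x. f x - (\<Sum>k\<in>F n. c n k * \<beta> k x))"
      unfolding C_def using partial_sum_interp[OF F] by (intro L2_norm_cong) (simp add: space_restrict_space)
    then show ?thesis
      using close[of n] e_pos[of n] L2_norm_le_ennreal[of "e n" "\<lambda>x. f x - interp (C n) x"] by (simp add: less_imp_le)
  qed
  \<comment> \<open>the constant relating the distance of two coefficients to the distance of the functions: the
    factor \<open>4\<close> comes from comparing two approximants through \<open>f\<close>\<close>
  define L where "L = sqrt ((real DIM('a) + 1) * (real DIM('a) + 2) / enn2real Vinf * 4)"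
  have L_nonneg: "0 \<le> L" using vinf_pos by (simp add: L_def)
  have diff: "cmod (C n w - C m w) \<le> L * e n" if w: "w \<in> V" and nm: "n \<le> m" for w n m
  proof -
    have "energy (interp (\<lambda>w. C n w - C m w)) = energy (\<lambda>x. interp (C n) x - interp (C m) x)"
      by (intro energy_cong) (simp only: interp_diff)
    also have "\<dots> \<le> 2 * energy (\<lambda>x. f x - interp (C n) x) + 2 * energy (\<lambda>x. f x - interp (C m) x)"
      by (intro energy_diff_le f_meas interp_measurable)
    also have "\<dots> \<le> 2 * ennreal ((e n)\<^sup>2) + 2 * ennreal ((e n)\<^sup>2)"
    proof -
      have "ennreal ((e m)\<^sup>2) \<le> ennreal ((e n)\<^sup>2)"
        using e_antimono[OF nm] e_pos[of m] by (intro ennreal_leI power_mono) auto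
      then show ?thesis
        by (intro add_mono mult_left_mono approx order_trans[OF approx[of m]]) auto
    qed
    also have "\<dots> = ennreal (4 * (e n)\<^sup>2)"
      by (simp add: mult_2 [symmetric] ennreal_mult)
    finally have "(cmod (C n w - C m w))\<^sup>2 \<le> (real DIM('a) + 1) * (real DIM('a) + 2) / enn2real Vinf * (4 * (e n)\<^sup>2)"
      using coefficient_le_energy[OF w, of "\<lambda>w. C n w - C m w" "4 * (e n)\<^sup>2"] by simp
    also have "\<dots> = (L * e n)\<^sup>2"
      using vinf_pos by (simp add: L_def power_mult_distrib)
    finally show ?thesis
      by (rule power2_le_imp_le) (intro mult_nonneg_nonneg L_nonneg less_imp_le[OF e_pos])
  qed
  have Le_lim: "(\<lambda>n. L * e n) \<longlonglongrightarrow> 0"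
    using tendsto_mult_right_zero[OF e_lim] .
  have "Cauchy (\<lambda>n. C n w)" if w: "w \<in> V" for w
  proof (rule metric_CauchyI)
    fix r :: real assume "0 < r"
    then have "\<forall>\<^sub>F n in sequentially. L * e n < r / 2"
      using Le_lim by (intro order_tendstoD(2)) auto
    then obtain N where N: "L * e N < r / 2" by (auto simp: eventually_sequentially)
    have "dist (C m w) (C n w) < r" if "m \<ge> N" "n \<ge> N" for m n
    proof -
      have "dist (C m w) (C n w) \<le> dist (C N w) (C m w) + dist (C N w) (C n w)"
        by (rule dist_triangle3)
      also have "\<dots> < r" using diff[OF w that(1)] diff[OF w that(2)] N by (simp add: dist_norm)
      finally show ?thesis .
    qed
    then show "\<exists>N. \<forall>m\<ge>N. \<forall>n\<ge>N. dist (C m w) (C n w) < r" by blast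
  qed
  then have "\<forall>w\<in>V. \<exists>z. (\<lambda>n. C n w) \<longlonglongrightarrow> z"
    using Cauchy_convergent convergent_def by blast
  then obtain c0 where c0: "\<And>w. w \<in> V \<Longrightarrow> (\<lambda>n. C n w) \<longlonglongrightarrow> c0 w" by metis
  define h where "h = interp c0"
  have unif: "cmod (interp (C n) x - h x) \<le> L * e n" if x: "x \<in> convex hull V" for n x
  proof -
    have "cmod (C n w - c0 w) \<le> L * e n" if w: "w \<in> V" for w
    proof (rule LIMSEQ_le_const2)
      show "(\<lambda>m. cmod (C n w - C m w)) \<longlonglongrightarrow> cmod (C n w - c0 w)"
        by (intro tendsto_intros c0 w)
      show "\<exists>N. \<forall>m\<ge>N. cmod (C n w - C m w) \<le> L * e n" using diff[OF w] by blast
    qed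
    then show ?thesis
      unfolding h_def interp_diff[OF x, symmetric] by (intro norm_interp_le x)
  qed
  have "continuous_on (convex hull V) h"
  proof (rule uniform_limit_theorem)
    show "\<forall>\<^sub>F n in sequentially. continuous_on (convex hull V) (interp (C n))"
      unfolding C_def using coeff_finite_continuous[OF beta F] by simp
    show "uniform_limit (convex hull V) (\<lambda>n. interp (C n)) h sequentially"
    proof (rule uniform_limitI)
      fix r :: real assume "0 < r"
      then have "\<forall>\<^sub>F n in sequentially. L * e n < r"
        using Le_lim by (intro order_tendstoD(2)) auto
      then show "\<forall>\<^sub>F n in sequentially. \<forall>x\<in>convex hull V. dist (interp (C n) x) (h x) < r"
        by (rule eventually_mono) (auto simp: dist_norm intro: le_less_trans[OF unif])
    qed
  qed simp
  then have h_cpwl: "h \<in> cpwl V S"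
    unfolding cpwl_def h_def using interp_affine by blast
  have "energy (\<lambda>x. f x - h x) \<le> 0"
  proof -
    have "energy (\<lambda>x. f x - h x) = (\<integral>\<^sup>+x. liminf (\<lambda>n. ennreal ((cmod (f x - interp (C n) x))\<^sup>2)) \<partial>M)"
      unfolding energy_def
    proof (rule nn_integral_cong)
      fix x assume "x \<in> space M"
      then have x: "x \<in> convex hull V" by (simp add: space_restrict_space)
      have "(\<lambda>n. ennreal ((cmod (f x - interp (C n) x))\<^sup>2)) \<longlonglongrightarrow> ennreal ((cmod (f x - h x))\<^sup>2)"
        unfolding h_def by (intro tendsto_intros tendsto_ennrealI interp_limit[OF x] c0)
      then show "ennreal ((cmod (f x - h x))\<^sup>2) = liminf (\<lambda>n. ennreal ((cmod (f x - interp (C n) x))\<^sup>2))"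
        by (intro lim_imp_Liminf[symmetric]) auto
    qed
    also have "\<dots> \<le> liminf (\<lambda>n. energy (\<lambda>x. f x - interp (C n) x))"
      unfolding energy_def
      using f_meas interp_measurable by (intro nn_integral_liminf) measurable
    also have "\<dots> \<le> liminf (\<lambda>n. ennreal ((e n)\<^sup>2))"
      by (intro Liminf_mono always_eventually allI approx)
    also have "\<dots> = 0"
    proof -
      have "(\<lambda>n. ennreal ((e n)\<^sup>2)) \<longlonglongrightarrow> ennreal (0\<^sup>2)"
        by (intro tendsto_ennrealI tendsto_power e_lim)
      then show ?thesis by (auto dest: lim_imp_Liminf[rotated])
    qed
    finally show ?thesis .
  qed
  then have "L2_norm M (\<lambda>x. f x - h x) = 0"
    unfolding L2_norm_energy by (simp add: esqrt_def)
  then have ae: "AE x in M. f x = h x"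
    using f_meas interp_measurable unfolding h_def by (intro L2_norm_eq_0_AE)
  then have "L2_norm M h = L2_norm M f"
    by (intro L2_norm_cong_AE) (auto elim!: eventually_mono)
  then have "h \<in> L2 M"
    using fL2 interp_measurable unfolding L2_def h_def by simp
  then show ?thesis
    using fL2 h_cpwl ae unfolding L2_classes_def by blast
qed

lemma riesz_basis_hats:
  assumes beta: "\<forall>k\<in>I. \<beta> k \<in> cpwl V S"
  shows "riesz_basis M I \<beta> (cpwl V S \<inter> L2 M)"
  unfolding riesz_basis_def
proof (intro conjI)
  show "\<forall>k\<in>I. \<beta> k \<in> cpwl V S \<inter> L2 M"
  proof
    fix k assume k: "k \<in> I"
    have "L2_norm M (\<beta> k) \<le> ennreal (sqrt (enn2real Vsup / (real DIM('a) + 1)))"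
      using riesz_inequality_bounds_members(2)[OF k beta_measurable[OF k] riesz_inequality_star] .
    then have "L2_norm M (\<beta> k) < \<infinity>" by (simp add: le_less_trans)
    then show "\<beta> k \<in> cpwl V S \<inter> L2 M"
      using beta k beta_measurable[OF k] unfolding L2_def by simp
  qed
  show "L2_closure M (fun_span I \<beta>) = L2_classes M (cpwl V S \<inter> L2 M)"
    using closure_in_cpwl_class[OF beta] cpwl_class_in_closure by blast
  show "\<exists>A B. 0 < A \<and> A \<le> B \<and> riesz_inequality M I \<beta> A B"
  proof (intro exI conjI)
    show "riesz_inequality M I \<beta> (sqrt (enn2real Vinf / ((real DIM('a) + 1) * (real DIM('a) + 2))))
        (sqrt (enn2real Vsup / (real DIM('a) + 1)))"
      by (rule riesz_inequality_star)
    show "0 < sqrt (enn2real Vinf / ((real DIM('a) + 1) * (real DIM('a) + 2)))"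
      using vinf_pos by simp
    show "sqrt (enn2real Vinf / ((real DIM('a) + 1) * (real DIM('a) + 2))) \<le> sqrt (enn2real Vsup / (real DIM('a) + 1))"
    proof -
      have "enn2real Vinf / ((real DIM('a) + 1) * (real DIM('a) + 2)) \<le> enn2real Vsup / (real DIM('a) + 1)"
        using vinf_le_vsup by (intro frac_le) (auto simp: algebra_simps)
      then show ?thesis by simp
    qed
  qed
qed

lemma Ninf_real: "enn2real (INF w\<in>V. L2_norm M (hat S w)) = sqrt (2 / ((real DIM('a) + 1) * (real DIM('a) + 2)) * enn2real Vinf)"
  unfolding Ninf_eq by (subst Vinf_eq) (simp add: ennreal_mult'[symmetric] esqrt_ennreal)

lemma Nsup_real: "enn2real (SUP w\<in>V. L2_norm M (hat S w)) = sqrt (2 / ((real DIM('a) + 1) * (real DIM('a) + 2)) * enn2real Vsup)"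
  unfolding Nsup_eq by (subst Vsup_eq) (simp add: ennreal_mult'[symmetric] esqrt_ennreal)

lemma norm_lower_bound_eq:
  "1 / sqrt 2 * enn2real (INF w\<in>V. L2_norm M (hat S w)) = sqrt (enn2real Vinf / ((real DIM('a) + 1) * (real DIM('a) + 2)))"
  unfolding Ninf_real by (simp add: real_sqrt_mult real_sqrt_divide)

lemma norm_upper_bound_eq:
  "sqrt ((real DIM('a) + 2) / 2) * enn2real (SUP w\<in>V. L2_norm M (hat S w)) = sqrt (enn2real Vsup / (real DIM('a) + 1))"
  unfolding Nsup_real real_sqrt_mult[symmetric] by simp

lemma norm_ratio_eq:
  "sqrt (enn2real Vsup / enn2real Vinf) =
    enn2real (SUP w\<in>V. L2_norm M (hat S w)) / enn2real (INF w\<in>V. L2_norm M (hat S w))"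
  unfolding Ninf_real Nsup_real real_sqrt_divide[symmetric] by simp

lemma condition_number_le:
  "riesz_condition_number M I \<beta> \<le> sqrt (real DIM('a) + 2) * sqrt (enn2real Vsup / enn2real Vinf)"
proof -
  obtain k where k: "k \<in> I" using nonempty indexing unfolding bij_betw_def by blast
  have "riesz_condition_number M I \<beta> \<le> sqrt (enn2real Vsup / (real DIM('a) + 1)) /
      sqrt (enn2real Vinf / ((real DIM('a) + 1) * (real DIM('a) + 2)))"
    using vinf_pos by (intro riesz_condition_number_le[OF k beta_measurable[OF k] riesz_inequality_star]) simp
  also have "\<dots> = sqrt (real DIM('a) + 2) * sqrt (enn2real Vsup / enn2real Vinf)"
  proof -
    have "a / p / (b / (p * q)) = q * (a / b)" if "0 < p" for a b p q :: real
      using that by simp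
    then show ?thesis
      unfolding real_sqrt_divide[symmetric] real_sqrt_mult[symmetric] by simp
  qed
  finally show ?thesis .
qed

end

theorem theorem1:
  fixes v :: "nat \<Rightarrow> 'a::euclidean_space"
    and I :: "nat set" and V :: "'a set" and S :: "'a set set"
  assumes "bij_betw v I V"
    and "locally_finite_set V"
    and "\<not> (\<exists>A. affine A \<and> aff_dim A = int DIM('a) - 1 \<and> V \<subseteq> A)"
    and "full_triangulation V S"
  shows
    "let M = lebesgue_on (convex hull V);
         \<beta> = (\<lambda>k x. complex_of_real (hat S (v k) x));
         d = real DIM('a);
         Vinf = (INF w\<in>V. star_vol S w);
         Vsup = (SUP w\<in>V. star_vol S w);
         Ninf = (INF w\<in>V. L2_norm M (hat S w));
         Nsup = (SUP w\<in>V. L2_norm M (hat S w));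
         st_i = riesz_basis M I \<beta> (cpwl V S \<inter> L2 M);
         st_ii = (Vinf > 0 \<and> Vsup < \<infinity>);
         st_iii = (Ninf > 0 \<and> Nsup < \<infinity>)
     in ((\<forall>k\<in>I. \<beta> k \<in> cpwl V S) \<longrightarrow> (st_i \<longleftrightarrow> st_ii)) \<and>
        (st_i \<longrightarrow> st_ii) \<and>
        (st_ii \<longleftrightarrow> st_iii) \<and>
        (st_ii \<longrightarrow>
           riesz_inequality M I \<beta>
             (sqrt (enn2real Vinf / ((d + 1) * (d + 2)))) (sqrt (enn2real Vsup / (d + 1))) \<and>
           riesz_inequality M I \<beta>
             (1 / sqrt 2 * enn2real Ninf) (sqrt ((d + 2) / 2) * enn2real Nsup) \<and>
           riesz_condition_number M I \<beta> \<le> sqrt (d + 2) * sqrt (enn2real Vsup / enn2real Vinf) \<and>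
           sqrt (d + 2) * sqrt (enn2real Vsup / enn2real Vinf)
             = sqrt (d + 2) * (enn2real Nsup / enn2real Ninf))"
proof -
  \<comment> \<open>the empty set lies in any hyperplane\<close>
  have nonempty: "V \<noteq> {}"
  proof
    assume "V = {}"
    obtain a :: 'a where "a \<in> Basis" using nonempty_Basis by blast
    then have "a \<noteq> 0" by (rule nonzero_Basis)
    then have "affine {x. a \<bullet> x = 0} \<and> aff_dim {x. a \<bullet> x = 0} = int DIM('a) - 1 \<and> V \<subseteq> {x. a \<bullet> x = 0}"
      using affine_hyperplane[of a 0] aff_dim_hyperplane[of a 0] \<open>V = {}\<close> by simp
    then show False using assms(3) by blast
  qed
  have "countable V"
    using assms(1) countable_image[of I v] unfolding bij_betw_def by auto
  then interpret T: indexed_triangulation V S v I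
    using assms(1,4) nonempty by unfold_locales auto
  let ?ii = "T.Vinf > 0 \<and> T.Vsup < \<infinity>"
  have i_ii: "riesz_basis T.M I T.\<beta> (cpwl V S \<inter> L2 T.M) \<Longrightarrow> ?ii"
    unfolding riesz_basis_def using T.riesz_inequality_imp_star_bounds by blast
  have loc: "bounded_stars V S v I" if "?ii"
    using that by unfold_locales auto
  show ?thesis
    unfolding Let_def T.Vinf_def[symmetric] T.Vsup_def[symmetric] T.star_bounds_iff_norm_bounds[symmetric]
  proof (intro conjI impI)
    assume "\<forall>k\<in>I. T.\<beta> k \<in> cpwl V S"
    then show "riesz_basis T.M I T.\<beta> (cpwl V S \<inter> L2 T.M) \<longleftrightarrow> ?ii"
      using i_ii bounded_stars.riesz_basis_hats[OF loc] by blast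
  next
    assume "?ii"
    then interpret B: bounded_stars V S v I by (rule loc)
    show "riesz_inequality T.M I T.\<beta> (sqrt (enn2real T.Vinf / ((real DIM('a) + 1) * (real DIM('a) + 2))))
        (sqrt (enn2real T.Vsup / (real DIM('a) + 1)))"
      by (rule B.riesz_inequality_star)
    then show "riesz_inequality T.M I T.\<beta> (1 / sqrt 2 * enn2real (INF w\<in>V. L2_norm T.M (hat S w)))
        (sqrt ((real DIM('a) + 2) / 2) * enn2real (SUP w\<in>V. L2_norm T.M (hat S w)))"
      unfolding B.norm_lower_bound_eq B.norm_upper_bound_eq .
    show "riesz_condition_number T.M I T.\<beta> \<le> sqrt (real DIM('a) + 2) * sqrt (enn2real T.Vsup / enn2real T.Vinf)"
      by (rule B.condition_number_le)
    show "sqrt (real DIM('a) + 2) * sqrt (enn2real T.Vsup / enn2real T.Vinf) = sqrt (real DIM('a) + 2) *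
       (enn2real (SUP w\<in>V. L2_norm T.M (hat S w)) / enn2real (INF w\<in>V. L2_norm T.M (hat S w)))"
      unfolding B.norm_ratio_eq ..
  qed (use i_ii in blast)+
qed

end
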